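(* Let $F$ be an algebraically closed field of characteristic different from $2$, let $G$ be a group, and let $UT_3=UT_3(F)$ be endowed with a non-trivial $G$-grading $\Gamma$ such that $\operatorname{supp}(\Gamma)$ generates $G$, and with a $G$-graded involution $*$ with respect to $\Gamma$. Let $f\in P_{m,l}^{G}$ be a multilinear graded $*$-polynomial. Then the image $f(UT_3)$ is a homogeneous vector subspace of $UT_3$.
   Context: $UT_n(F)$ is the algebra of $n\times n$ upper triangular matrices over $F$. An involution on an $F$-algebra $\mathcal{A}$ is (always of the first kind, i.e.) an $F$-linear map $*:\mathcal{A}\to\mathcal{A}$ with $(ab)^*=b^*a^*$ and $(a^* )^*=a$. A $G$-grading on $\mathcal{A}$ is a decomposition $\Gamma:\mathcal{A}=\bigoplus_{g\in G}\mathcal{A}_g$ into subspaces with $\mathcal{A}_g\mathcal{A}_h\subset\mathcal{A}_{gh}$; $\operatorname{supp}(\Gamma)=\{g\in G:\mathcal{A}_g\neq 0\}$; the grading is trivial if $\mathcal{A}=\mathcal{A}_1$ and non-trivial otherwise. The involution $*$ is $G$-graded if $\mathcal{A}_g^*\subset\mathcal{A}_g$ for all $g\in G$. Put $\mathcal{S}_g=\{a\in\mathcal{A}_g: a^*=a\}$ and $\mathcal{K}_g=\{a\in\mathcal{A}_g:a^*=-a\}$. A subspace $\mathcal{V}\subset\mathcal{A}$ is homogeneous if $\mathcal{V}=\bigoplus_{g\in G}(\mathcal{V}\cap\mathcal{A}_g)$. Let $F\langle Y_G\cup Z_G\rangle$ be the free associative algebra on the variables $y_{i,g}$ (symmetric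 of degree $g$) and $z_{i,g}$ (skew-symmetric of degree $g$), $i\ge 1$, $g\in G$. For $m\ge 1$, $0\le l\le m$ and fixed degrees $g_1,\dots,g_m\in G$, set $\xi_i=y_{i,g_i}$ for $1\le i\le l$ and $\xi_i=z_{i,g_i}$ for $l+1\le i\le m$; then $P_{m,l}^{G}=\operatorname{span}_F\{\xi_{\sigma(1)}\cdots\xi_{\sigma(m)}:\sigma\in S_m\}$. For $f=f(y_{1,g_1},\dots,y_{l,g_l},z_{l+1,g_{l+1}},\dots,z_{m,g_m})\in P_{m,l}^{G}$, the image $f(\mathcal{A})$ is the set of all values $f(a_1,\dots,a_l,b_{l+1},\dots,b_m)$ with $a_i\in\mathcal{S}_{g_i}$ and $b_j\in\mathcal{K}_{g_j}$. *)

theory Defs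
  imports "HOL-Analysis.Analysis" "HOL-Algebra.Generated_Groups" "HOL-Library.Poly_Mapping"
begin

section \<open>Matrices over a field\<close>

text \<open>
  The product of matrices is \<open>**\<close> and the identity matrix is \<open>mat 1\<close>; the class operations \<open>*\<close>
  and \<open>1\<close> on \<^typ>\<open>'f ^ 'n ^ 'n\<close> are entrywise and are never used here.
\<close>

definition mscale :: "'f::field \<Rightarrow> 'f ^ 'n ^ 'n \<Rightarrow> 'f ^ 'n ^ 'n"
  where "mscale c A = map_matrix ((*) c) A"

interpretation matrices: vector_space mscale
  by unfold_locales (simp_all add: mscale_def vec_eq_iff algebra_simps)

text \<open>
  The numeral type \<open>3\<close> is a linear order with elements \<open>0 < 1 < 2\<close>, so \<open>UT\<close> at type \<open>'f ^ 3 ^ 3\<close> is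
  the algebra of upper triangular \<open>3 \<times> 3\<close> matrices.
\<close>

definition UT :: "('f::field ^ 'n::{finite,linorder} ^ 'n::{finite,linorder}) set"
  where "UT = {A. \<forall>i j. j < i \<longrightarrow> A $ i $ j = 0}"


section \<open>Gradings and graded involutions\<close>

definition internal_direct_sum ::
    "'i set \<Rightarrow> ('i \<Rightarrow> ('f::field ^ 'n ^ 'n) set) \<Rightarrow> ('f ^ 'n ^ 'n) set \<Rightarrow> bool"
  where "internal_direct_sum I V W \<longleftrightarrow>
    (\<forall>i\<in>I. matrices.subspace (V i)) \<and>
    W = {(\<Sum>i\<in>J. x i) | J x. finite J \<and> J \<subseteq> I \<and> (\<forall>i\<in>J. x i \<in> V i)} \<and>
    (\<forall>J x. finite J \<longrightarrow> J \<subseteq> I \<longrightarrow> (\<forall>i\<in>J. x i \<in> V i) \<longrightarrow> (\<Sum>i\<in>J. x i) = 0 \<longrightarrow> (\<forall>i\<in>J. x i = 0))"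

text \<open>Below, \<open>A\<close> is a set of matrices forming an algebra and \<open>\<Gamma> g\<close> is its component of degree \<open>g\<close>.\<close>

definition grading ::
    "('g, 'k) monoid_scheme \<Rightarrow> ('f::field ^ 'n ^ 'n) set \<Rightarrow> ('g \<Rightarrow> ('f ^ 'n ^ 'n) set) \<Rightarrow> bool"
  where "grading G A \<Gamma> \<longleftrightarrow>
    internal_direct_sum (carrier G) \<Gamma> A \<and>
    (\<forall>g\<in>carrier G. \<forall>h\<in>carrier G. \<forall>a\<in>\<Gamma> g. \<forall>b\<in>\<Gamma> h. a ** b \<in> \<Gamma> (g \<otimes>\<^bsub>G\<^esub> h))"

definition supp :: "('g, 'k) monoid_scheme \<Rightarrow> ('g \<Rightarrow> ('f::field ^ 'n ^ 'n) set) \<Rightarrow> 'g set"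
  where "supp G \<Gamma> = {g \<in> carrier G. \<Gamma> g \<noteq> {0}}"

definition trivial_grading ::
    "('g, 'k) monoid_scheme \<Rightarrow> ('f::field ^ 'n ^ 'n) set \<Rightarrow> ('g \<Rightarrow> ('f ^ 'n ^ 'n) set) \<Rightarrow> bool"
  where "trivial_grading G A \<Gamma> \<longleftrightarrow> A = \<Gamma> \<one>\<^bsub>G\<^esub>"

definition homogeneous ::
    "('g, 'k) monoid_scheme \<Rightarrow> ('g \<Rightarrow> ('f::field ^ 'n ^ 'n) set) \<Rightarrow> ('f ^ 'n ^ 'n) set \<Rightarrow> bool"
  where "homogeneous G \<Gamma> V \<longleftrightarrow> internal_direct_sum (carrier G) (\<lambda>g. V \<inter> \<Gamma> g) V"

definition involution ::
    "('f::field ^ 'n ^ 'n) set \<Rightarrow> ('f ^ 'n ^ 'n \<Rightarrow> 'f ^ 'n ^ 'n) \<Rightarrow> bool"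
  where "involution A star \<longleftrightarrow>
    (\<forall>a\<in>A. star a \<in> A) \<and>
    (\<forall>a\<in>A. \<forall>b\<in>A. star (a + b) = star a + star b) \<and>
    (\<forall>c. \<forall>a\<in>A. star (mscale c a) = mscale c (star a)) \<and>
    (\<forall>a\<in>A. \<forall>b\<in>A. star (a ** b) = star b ** star a) \<and>
    (\<forall>a\<in>A. star (star a) = a)"

definition graded_involution ::
    "('g, 'k) monoid_scheme \<Rightarrow> ('f::field ^ 'n ^ 'n) set \<Rightarrow> ('g \<Rightarrow> ('f ^ 'n ^ 'n) set)
      \<Rightarrow> ('f ^ 'n ^ 'n \<Rightarrow> 'f ^ 'n ^ 'n) \<Rightarrow> bool"
  where "graded_involution G A \<Gamma> star \<longleftrightarrow>
    involution A star \<and> (\<forall>g\<in>carrier G. star ` \<Gamma> g \<subseteq> \<Gamma> g)"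

definition symmetric_part ::
    "('g \<Rightarrow> ('f::field ^ 'n ^ 'n) set) \<Rightarrow> ('f ^ 'n ^ 'n \<Rightarrow> 'f ^ 'n ^ 'n) \<Rightarrow> 'g \<Rightarrow> ('f ^ 'n ^ 'n) set"
  where "symmetric_part \<Gamma> star g = {a \<in> \<Gamma> g. star a = a}"

definition skew_part ::
    "('g \<Rightarrow> ('f::field ^ 'n ^ 'n) set) \<Rightarrow> ('f ^ 'n ^ 'n \<Rightarrow> 'f ^ 'n ^ 'n) \<Rightarrow> 'g \<Rightarrow> ('f ^ 'n ^ 'n) set"
  where "skew_part \<Gamma> star g = {a \<in> \<Gamma> g. star a = - a}"


section \<open>The free algebra\<close>

text \<open>
  The free associative algebra is the monoid algebra of the free monoid. The library multiplies
  finitely supported functions by convolution along \<open>+\<close> on the exponents, so the free monoid of words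
  is written additively; its \<open>+\<close> is concatenation and not commutative.
\<close>

datatype 'v free_monoid = Word (letters: "'v list")

instantiation free_monoid :: (type) monoid_add
begin

definition zero_free_monoid :: "'a free_monoid"
  where "0 = Word []"

definition plus_free_monoid :: "'a free_monoid \<Rightarrow> 'a free_monoid \<Rightarrow> 'a free_monoid"
  where "u + v = Word (letters u @ letters v)"

instance
  by standard (simp_all add: zero_free_monoid_def plus_free_monoid_def)

end

type_synonym ('v, 'f) free_algebra = "'v free_monoid \<Rightarrow>\<^sub>0 'f"

definition variable :: "'v \<Rightarrow> ('v, 'f::field) free_algebra"
  where "variable v = Poly_Mapping.single (Word [v]) 1"

definition fscale :: "'f::field \<Rightarrow> ('v, 'f) free_algebra \<Rightarrow> ('v, 'f) free_algebra"
  where "fscale c f = Poly_Mapping.map ((*) c) f"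

lemma lookup_fscale [simp]: "Poly_Mapping.lookup (fscale c f) w = c * Poly_Mapping.lookup f w"
  by (simp add: fscale_def map.rep_eq when_def)

interpretation free_algebra: vector_space fscale
  by unfold_locales (simp_all add: poly_mapping_eq_iff fun_eq_iff lookup_add algebra_simps)

definition eval_word :: "('v \<Rightarrow> 'f::field ^ 'n ^ 'n) \<Rightarrow> 'v free_monoid \<Rightarrow> 'f ^ 'n ^ 'n"
  where "eval_word \<phi> w = foldr (\<lambda>v M. \<phi> v ** M) (letters w) (mat 1)"

definition eval :: "('v \<Rightarrow> 'f::field ^ 'n ^ 'n) \<Rightarrow> ('v, 'f) free_algebra \<Rightarrow> 'f ^ 'n ^ 'n"
  where "eval \<phi> f =
    (\<Sum>w \<in> Poly_Mapping.keys f. mscale (Poly_Mapping.lookup f w) (eval_word \<phi> w))"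


text \<open>Evaluation at \<open>\<phi>\<close> is the homomorphism of unital algebras that extends \<open>\<phi>\<close>.\<close>

lemma eval_superset:
  assumes "finite S" "Poly_Mapping.keys f \<subseteq> S"
  shows "eval \<phi> f = (\<Sum>w\<in>S. mscale (Poly_Mapping.lookup f w) (eval_word \<phi> w))"
  unfolding eval_def using assms
  by (intro sum.mono_neutral_left) (auto simp: in_keys_iff)

lemma eval_variable [simp]: "eval \<phi> (variable v) = \<phi> v"
  by (simp add: eval_def variable_def eval_word_def)

lemma eval_one [simp]: "eval \<phi> (1 :: ('v, 'f::field) free_algebra) = mat 1"
  by (simp add: eval_def eval_word_def zero_free_monoid_def flip: single_one)

lemma eval_add: "eval \<phi> (p + q) = eval \<phi> p + eval \<phi> q"
proof -
  let ?S = "Poly_Mapping.keys p \<union> Poly_Mapping.keys q"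
  have "Poly_Mapping.keys (p + q) \<subseteq> ?S"
    by (rule Poly_Mapping.keys_add)
  then show ?thesis
    by (simp add: eval_superset[of ?S] lookup_add matrices.scale_left_distrib sum.distrib)
qed

lemma eval_fscale: "eval \<phi> (fscale c p) = mscale c (eval \<phi> p)"
proof -
  have "Poly_Mapping.keys (fscale c p) \<subseteq> Poly_Mapping.keys p"
    by (auto simp: in_keys_iff)
  then show ?thesis
    by (simp add: eval_superset[of "Poly_Mapping.keys p"] matrices.scale_sum_right)
qed

lemma eval_word_add: "eval_word \<phi> (u + v) = eval_word \<phi> u ** eval_word \<phi> v"
proof -
  have "foldr (\<lambda>v M. \<phi> v ** M) xs N = foldr (\<lambda>v M. \<phi> v ** M) xs (mat 1) ** N" for xs N
    by (induction xs) (simp_all add: matrix_mul_assoc)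
  then show ?thesis
    unfolding eval_word_def plus_free_monoid_def
    by (metis foldr_append comp_apply free_monoid.sel)
qed

lemma eval_single [simp]: "eval \<phi> (Poly_Mapping.single w c) = mscale c (eval_word \<phi> w)"
  by (subst eval_superset[of "{w}"]) (auto simp: in_keys_iff lookup_single when_def split: if_splits)

lemma matrix_right_distrib: "(A + B) ** C = A ** C + B ** (C :: 'f::field ^ 'n ^ 'n)"
  by (simp add: vec_eq_iff matrix_matrix_mult_def distrib_right sum.distrib)

lemma mscale_mult_mscale: "mscale a A ** mscale b B = mscale (a * b) (A ** B)"
  by (simp add: mscale_def vec_eq_iff matrix_matrix_mult_def sum_distrib_left algebra_simps)

lemma free_algebra_induct [case_names zero add_single]:
  fixes p :: "('v, 'f::field) free_algebra"
  assumes "P 0" and "\<And>p w c. P p \<Longrightarrow> P (p + Poly_Mapping.single w c)"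
  shows "P p"
proof (induction p rule: update_induct)
  case const
  show ?case by (rule assms(1))
next
  case (update p w c)
  have "Poly_Mapping.update w c p = p + Poly_Mapping.single w c"
    using update(1)
    by (intro poly_mapping_eqI)
      (auto simp: lookup_update lookup_add lookup_single when_def in_keys_iff)
  then show ?case
    using assms(2)[OF update(3)] by simp
qed

lemma eval_zero [simp]: "eval \<phi> 0 = 0"
  by (simp add: eval_def)

lemma eval_mult: "eval \<phi> (p * q) = eval \<phi> p ** eval \<phi> q"
proof (induction p rule: free_algebra_induct)
  case zero
  show ?case by simp
next
  case (add_single p u a)
  have "eval \<phi> (Poly_Mapping.single u a * q) = mscale a (eval_word \<phi> u) ** eval \<phi> q"
  proof (induction q rule: free_algebra_induct)
    case zero
    show ?case by simp
  next
    case (add_single q v b)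
    then show ?case
      by (simp add: distrib_left eval_add matrix_add_ldistrib mult_single eval_word_add
          mscale_mult_mscale)
  qed
  with add_single show ?case
    by (simp add: distrib_right eval_add matrix_right_distrib)
qed

section \<open>Multilinear graded polynomials with involution and their images\<close>

text \<open>
  \<open>Sym i g\<close> and \<open>Skew i g\<close> are the symmetric and the skew-symmetric variable number \<open>i\<close> of degree \<open>g\<close>.
\<close>

datatype 'g star_variable = Sym nat 'g | Skew nat 'g

definition xi :: "nat \<Rightarrow> (nat \<Rightarrow> 'g) \<Rightarrow> nat \<Rightarrow> 'g star_variable"
  where "xi l g i = (if i \<le> l then Sym i (g i) else Skew i (g i))"

definition multilinear_polys ::
    "nat \<Rightarrow> nat \<Rightarrow> (nat \<Rightarrow> 'g) \<Rightarrow> ('g star_variable, 'f::field) free_algebra set"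
  where "multilinear_polys m l g = free_algebra.span
    {prod_list (map (\<lambda>i. variable (xi l g (\<sigma> i))) [1..<Suc m]) | \<sigma>. \<sigma> permutes {1..m}}"

text \<open>
  A substitution \<open>\<phi>\<close> assigns a matrix to every variable. Only the variables \<open>xi l g 1, \<dots>, xi l g m\<close>
  are constrained, as no others occur in the elements of \<open>multilinear_polys m l g\<close>.
\<close>

definition poly_image ::
    "('g \<Rightarrow> ('f::field ^ 'n ^ 'n) set) \<Rightarrow> ('f ^ 'n ^ 'n \<Rightarrow> 'f ^ 'n ^ 'n)
      \<Rightarrow> nat \<Rightarrow> nat \<Rightarrow> (nat \<Rightarrow> 'g) \<Rightarrow> ('g star_variable, 'f) free_algebra \<Rightarrow> ('f ^ 'n ^ 'n) set"
  where "poly_image \<Gamma> star m l g f = {eval \<phi> f | \<phi>.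
    (\<forall>i\<in>{1..l}. \<phi> (Sym i (g i)) \<in> symmetric_part \<Gamma> star (g i)) \<and>
    (\<forall>j\<in>{l+1..m}. \<phi> (Skew j (g j)) \<in> skew_part \<Gamma> star (g j))}"

end

theory Submission
  imports Defs
begin

text \<open>
  Write \<open>J\<close> for the strictly upper triangular matrices (\<open>SUT\<close> below) and \<open>e\<close> for the corner unit
  \<open>unit_mat 0 2\<close>. The values of a multilinear map with at most two-dimensional target always form a
  subspace (\<open>image_subspace\<close>). The proof shows that the values of \<open>f\<close> lie in a homogeneous plane,
  except in one case, where they are understood directly.

  The structure of the grading is found without classifying gradings or involutions. If
  \<open>x ** y \<noteq> 0\<close> for homogeneous \<open>x\<close> and \<open>y\<close>, then applying the involution shows that their
  degrees commute. So commutators of homogeneous elements are homogeneous, and \<open>J\<close>, being spanned by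
  commutators, is spanned by homogeneous elements. Suitable two of these have a nonzero multiple of \<open>e\<close> as their product, and since
  a diagonal entry of \<open>x\<close> is the factor by which \<open>x\<close> changes such a product, every homogeneous
  element with nonzero diagonal has degree \<open>\<one>\<close> (\<open>diagonal_entry_degree\<close>). With
  diagonal idempotents modulo \<open>J\<close> of degree \<open>\<one>\<close> at hand, one finds a homogeneous \<open>w\<close> of some degree
  \<open>a\<close> that agrees with a multiple of \<open>unit_mat 0 1\<close> up to the corner. The involution reverses the
  diagonal, so that \<open>star w\<close>, again of degree \<open>a\<close>, agrees with a multiple of \<open>unit_mat 1 2\<close> up to
  the corner, and \<open>w ** star w\<close> shows that \<open>e\<close> is symmetric of degree \<open>a \<otimes> a\<close>. The grading being
  nontrivial means \<open>a \<noteq> \<one>\<close>. Hence the support lies in \<open>{\<one>, a, a \<otimes> a}\<close>, and \<open>J\<close> meets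
  \<open>\<Gamma> a\<close> in the plane spanned by \<open>w\<close> and \<open>star w\<close>, and every other component in at most the line
  of \<open>e\<close>.

  A variable whose degree is not in the support takes only the value zero, and then so does \<open>f\<close>.
  Otherwise all degrees are powers of \<open>a\<close>, and the monomials of \<open>f\<close> have the same degree \<open>h\<close>, whatever the
  order of the factors. If some variable has degree different from \<open>\<one>\<close>, its values lie in \<open>J\<close>, and
  those of \<open>f\<close> lie in \<open>J \<inter> \<Gamma> h\<close>, at most a plane. If all variables have degree \<open>\<one>\<close> and some are
  skew-symmetric, the diagonal of every value is a multiple of one fixed vector \<open>(1, 0, \<plusminus> 1)\<close>, and
  only the corner entry is free besides it: a plane again. If all variables are symmetric of degree
  \<open>\<one>\<close>, then they take values in a commutative unital algebra, because commutators of symmetric elements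
  are skew-symmetric multiples of the symmetric \<open>e\<close>. There \<open>f\<close> is a scalar multiple of the product of
  its variables.
\<close>

section \<open>Multilinear maps with values in a plane\<close>

text \<open>
  Two vectors span a plane: a symmetric form of linear independence that survives the exchange steps
  below without any bookkeeping on whether the two vectors coincide.
\<close>

definition (in vector_space) noncollinear :: "'b \<Rightarrow> 'b \<Rightarrow> bool"
  where "noncollinear p q \<longleftrightarrow> (\<forall>a b. scale a p = scale b q \<longrightarrow> a = 0 \<and> b = 0)"

context vector_space
begin

lemma noncollinear_nonzero:
  assumes "noncollinear p q"
  shows "p \<noteq> 0" "q \<noteq> 0"
proof -
  show "p \<noteq> 0"
    using assms[unfolded noncollinear_def, rule_format, of 1 0] by auto
  show "q \<noteq> 0"
    using assms[unfolded noncollinear_def, rule_format, of 0 1] by auto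
qed

lemma not_noncollinearE:
  assumes "\<not> noncollinear p q" "q \<noteq> 0"
  obtains a where "p = scale a q"
proof -
  obtain a b where ab: "scale a p = scale b q" "a \<noteq> 0 \<or> b \<noteq> 0"
    using assms(1) by (auto simp: noncollinear_def)
  have "a \<noteq> 0"
    using ab assms(2) by auto
  then have "p = scale (inverse a) (scale a p)"
    by simp
  also have "\<dots> = scale (inverse a * b) q"
    using ab(1) by simp
  finally show thesis by (rule that)
qed

lemma noncollinear_spans_plane:
  assumes pq: "noncollinear p q" and "p \<in> span {u, v}" "q \<in> span {u, v}"
    and x: "x \<in> span {u, v}"
  obtains a b where "x = scale a p + scale b q"
proof -
  have "p \<noteq> q"
    using pq[unfolded noncollinear_def, rule_format, of 1 1] by auto
  have "p \<notin> span {q}"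
  proof
    assume "p \<in> span {q}"
    then obtain k where "p = scale k q"
      by (metis span_breakdown_eq span_empty singletonD right_minus_eq)
    then show False
      using pq[unfolded noncollinear_def, rule_format, of 1 k] by auto
  qed
  moreover have "independent {q}"
    using noncollinear_nonzero(2)[OF pq] by (simp add: dependent_single)
  ultimately have ind: "independent {p, q}"
    using \<open>p \<noteq> q\<close> by (simp add: independent_insert)
  have "x \<in> span {p, q}"
  proof (rule ccontr)
    assume x': "x \<notin> span {p, q}"
    then have "x \<notin> {p, q}"
      using span_superset[of "{p, q}"] by auto
    have "independent {x, p, q}"
      using ind independent_insertI[OF x'] by blast
    then have "card {x, p, q} \<le> card {u, v}"
      using independent_span_bound[of "{u, v}" "{x, p, q}"] assms(2,3) x by auto
    moreover have "card {x, p, q} = 3"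
      using \<open>x \<notin> {p, q}\<close> \<open>p \<noteq> q\<close> by simp
    ultimately show False
      by (simp add: card_insert_if split: if_splits)
  qed
  then obtain a b where "x - scale a p - scale b q = 0"
    by (auto simp: span_breakdown_eq)
  then show thesis
    using that[of a b] by (simp add: algebra_simps)
qed

end

text \<open>
  The arguments are the coordinates \<open>v i\<close> with \<open>i \<in> I\<close> of a function \<open>v\<close>, so that the map does
  not depend on the order of its arguments and one of them can be changed by updating \<open>v\<close>.
\<close>

locale multilinear_map = vector_space_pair s1 s2
  for s1 :: "'a::field \<Rightarrow> 'b::ab_group_add \<Rightarrow> 'b" and s2 :: "'a \<Rightarrow> 'c::ab_group_add \<Rightarrow> 'c" +
  fixes I :: "'i set" and V :: "'i \<Rightarrow> 'b set" and F :: "('i \<Rightarrow> 'b) \<Rightarrow> 'c"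
  assumes finite: "finite I"
    and V: "\<And>i. i \<in> I \<Longrightarrow> vs1.subspace (V i)"
    and cong: "\<And>v u. (\<And>i. i \<in> I \<Longrightarrow> v i = u i) \<Longrightarrow> F v = F u"
    and comb: "\<And>v i x y a b. (\<And>i. i \<in> I \<Longrightarrow> v i \<in> V i) \<Longrightarrow> i \<in> I \<Longrightarrow> x \<in> V i \<Longrightarrow> y \<in> V i \<Longrightarrow>
      F (v(i := s1 a x + s1 b y)) = s2 a (F (v(i := x))) + s2 b (F (v(i := y)))"
begin

text \<open>
  Two noncollinear values at \<open>v\<close> and \<open>u\<close> can be moved until the arguments differ in one coordinate.
  Put \<open>u i\<close> into \<open>v\<close> at a coordinate \<open>i\<close> where they differ, and vice versa. Unless this gives a closer
  pair or a pair as wanted, both new values vanish; then \<open>v i + u i\<close> at \<open>i\<close> changes neither of the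
  original values and makes the arguments agree there.
\<close>

lemma noncollinear_values_adjacent:
  assumes "\<And>i. i \<in> I \<Longrightarrow> v i \<in> V i" "\<And>i. i \<in> I \<Longrightarrow> u i \<in> V i" "vs2.noncollinear (F v) (F u)"
  obtains v i y where "\<And>i. i \<in> I \<Longrightarrow> v i \<in> V i" "i \<in> I" "y \<in> V i"
    "vs2.noncollinear (F v) (F (v(i := y)))"
proof -
  have "\<exists>v i y. (\<forall>i\<in>I. v i \<in> V i) \<and> i \<in> I \<and> y \<in> V i \<and> vs2.noncollinear (F v) (F (v(i := y)))"
    using assms
  proof (induction "card {i \<in> I. v i \<noteq> u i}" arbitrary: v u rule: less_induct)
    case less
    note v = less.prems(1) and u = less.prems(2) and vu = less.prems(3)
    have "F v \<noteq> F u"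
      using vu[unfolded vs2.noncollinear_def, rule_format, of 1 1] by auto
    then obtain i where i: "i \<in> I" "v i \<noteq> u i"
      using cong by blast
    let ?v = "v(i := u i)" and ?u = "u(i := v i)"
    let ?v' = "v(i := v i + u i)" and ?u' = "u(i := v i + u i)"
    have dec: "card {j \<in> I. v' j \<noteq> u' j} < card {j \<in> I. v j \<noteq> u j}"
      if "v' i = u' i" "\<And>j. j \<noteq> i \<Longrightarrow> v' j = v j \<and> u' j = u j" for v' u'
    proof (rule psubset_card_mono)
      have "{j \<in> I. v' j \<noteq> u' j} \<subseteq> {j \<in> I. v j \<noteq> u j} - {i}"
      proof
        fix j
        assume "j \<in> {j \<in> I. v' j \<noteq> u' j}"
        then show "j \<in> {j \<in> I. v j \<noteq> u j} - {i}"
          using that by (cases "j = i") auto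
      qed
      then show "{j \<in> I. v' j \<noteq> u' j} \<subset> {j \<in> I. v j \<noteq> u j}"
        using i by blast
    qed (use finite in simp)
    have v': "?v j \<in> V j" and u': "?u j \<in> V j" if "j \<in> I" for j
      using that v u by auto
    consider "vs2.noncollinear (F ?v) (F u)" | "vs2.noncollinear (F v) (F ?u)"
      | "vs2.noncollinear (F v) (F ?v)" | "vs2.noncollinear (F u) (F ?u)"
      | "F ?v = 0" "F ?u = 0"
    proof -
      have nz: "F v \<noteq> 0" "F u \<noteq> 0"
        using vs2.noncollinear_nonzero[OF vu] by auto
      have zero: "p = 0" if p: "\<not> vs2.noncollinear p (F v)" "\<not> vs2.noncollinear p (F u)" for p
      proof -
        obtain a where a: "p = s2 a (F v)"
          by (rule vs2.not_noncollinearE[OF p(1) nz(1)])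
        obtain b where b: "p = s2 b (F u)"
          by (rule vs2.not_noncollinearE[OF p(2) nz(2)])
        have "a = 0"
          using vu a b unfolding vs2.noncollinear_def by metis
        then show ?thesis using a by simp
      qed
      have "vs2.noncollinear q p" if "vs2.noncollinear p q" for p q
        using that by (metis vs2.noncollinear_def)
      then show thesis using zero that by blast
    qed
    then show ?case
    proof cases
      case 1
      then show ?thesis
        using less.hyps[of ?v u] dec[of ?v u] v' u by auto
    next
      case 2
      then show ?thesis
        using less.hyps[of v ?u] dec[of v ?u] v u' by auto
    next
      case 3
      then show ?thesis using v u i by blast
    next
      case 4
      then show ?thesis using v u i by blast
    next
      case 5
      have "F ?v' = F v" "F ?u' = F u"
        using comb[of v i "v i" "u i" 1 1] comb[of u i "v i" "u i" 1 1]
          v u i 5 by auto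
      moreover have "?v' j \<in> V j" "?u' j \<in> V j" if "j \<in> I" for j
        using that v u V[of i] i vs1.subspace_add by auto
      ultimately show ?thesis
        using less.hyps[of ?v' ?u'] dec[of ?v' ?u'] vu by simp
    qed
  qed
  then show thesis using that by blast
qed

text \<open>
  If all values of a multilinear map are collinear, scaling one argument shows that they form a line or
  the zero space. Otherwise two noncollinear values arise from arguments that differ in one coordinate,
  and the map is linear in that coordinate, so it attains the whole plane. In dimension three this
  fails over every field: the values \<open>(x\<^sub>1 y\<^sub>1, x\<^sub>1 y\<^sub>2, x\<^sub>2 y\<^sub>1)\<close> contain \<open>(0, 1, 0)\<close> and \<open>(0, 0, 1)\<close>
  but not their sum.
\<close>

lemma image_subspace:
  assumes "I \<noteq> {}" and plane: "\<And>v. (\<And>i. i \<in> I \<Longrightarrow> v i \<in> V i) \<Longrightarrow> F v \<in> vs2.span {p, q}"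
  shows "vs2.subspace {F v | v. \<forall>i\<in>I. v i \<in> V i}"
proof -
  let ?im = "{F v | v. \<forall>i\<in>I. v i \<in> V i}"
  have scale: "s2 a x \<in> ?im" if x: "x \<in> ?im" for a x
  proof -
    obtain v where v: "x = F v" "\<forall>i\<in>I. v i \<in> V i"
      using x by blast
    obtain i where i: "i \<in> I"
      using \<open>I \<noteq> {}\<close> by blast
    have "F (v(i := s1 a (v i))) = s2 a (F v)"
      using comb[of v i "v i" "v i" a 0] v i by auto
    moreover have "(v(i := s1 a (v i))) j \<in> V j" if "j \<in> I" for j
      using v V i that vs1.subspace_scale by auto
    ultimately show ?thesis
      using v(1) by (intro CollectI exI[of _ "v(i := s1 a (v i))"]) simp
  qed
  have "(\<lambda>_. 0) i \<in> V i" if "i \<in> I" for i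
    using vs1.subspace_0 V that by auto
  then have "F (\<lambda>_. 0) \<in> ?im"
    by blast
  then have zero: "0 \<in> ?im"
    using scale[of "F (\<lambda>_. 0)" 0] by simp
  have add: "x + y \<in> ?im" if x: "x \<in> ?im" and y: "y \<in> ?im" for x y
  proof (cases "\<exists>v u. (\<forall>i\<in>I. v i \<in> V i) \<and> (\<forall>i\<in>I. u i \<in> V i) \<and> vs2.noncollinear (F v) (F u)")
    case True
    then obtain v i z where v: "\<And>i. i \<in> I \<Longrightarrow> v i \<in> V i" "i \<in> I" "z \<in> V i"
      and nc: "vs2.noncollinear (F v) (F (v(i := z)))"
      using noncollinear_values_adjacent by blast
    have "F v \<in> vs2.span {p, q}" "F (v(i := z)) \<in> vs2.span {p, q}"
      using v by (auto intro!: plane)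
    moreover have "x + y \<in> vs2.span {p, q}"
      using x y plane by (auto intro!: vs2.span_add)
    ultimately obtain a b where ab: "x + y = s2 a (F v) + s2 b (F (v(i := z)))"
      by (rule vs2.noncollinear_spans_plane[OF nc])
    have "F (v(i := s1 a (v i) + s1 b z)) = x + y"
      using comb[of v i "v i" z a b] v ab by auto
    moreover have "(v(i := s1 a (v i) + s1 b z)) j \<in> V j" if "j \<in> I" for j
      using v V[of i] that by (auto intro!: vs1.subspace_add vs1.subspace_scale)
    ultimately show ?thesis
      by (intro CollectI exI[of _ "v(i := s1 a (v i) + s1 b z)"]) simp
  next
    case False
    then have nc: "\<not> vs2.noncollinear x y"
      using x y by auto
    show ?thesis
    proof (cases "y = 0")
      case False
      with nc obtain a where "x = s2 a y"
        by (rule vs2.not_noncollinearE)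
      then have "x + y = s2 (a + 1) y"
        by (simp add: vs2.scale_left_distrib)
      then show ?thesis using scale[OF y, of "a + 1"] by simp
    qed (use x in auto)
  qed
  show ?thesis
    by (rule vs2.subspaceI[OF zero add scale])
qed

end

section \<open>Upper triangular matrices of size three\<close>

text \<open>In the order of the type \<open>3\<close> the index \<open>3 = 0\<close> comes first, so rows are numbered \<open>0, 1, 2\<close>.\<close>

lemma UNIV_3_from_zero: "(UNIV :: 3 set) = {0, 1, 2}"
  using UNIV_3 by auto

lemma sum_3_from_zero: "sum f (UNIV :: 3 set) = f 0 + f 1 + f 2"
  unfolding UNIV_3_from_zero by (simp add: add.assoc)

lemma forall_3_from_zero: "(\<forall>i::3. P i) \<longleftrightarrow> P 0 \<and> P 1 \<and> P 2"
  by (metis UNIV_3_from_zero UNIV_I insertE singletonD)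

lemma less_3_simps [simp]:
  "(0::3) < 1" "(0::3) < 2" "(1::3) < 2" "\<not> (1::3) < 0" "\<not> (2::3) < 0" "\<not> (2::3) < 1"
  by (simp_all add: less_bit1_def bit1.Rep_0 bit1.Rep_1 bit1.Rep_numeral)

lemma UT_iff:
  fixes A :: "'f::field ^ 3 ^ 3"
  shows "A \<in> UT \<longleftrightarrow> A $ 1 $ 0 = 0 \<and> A $ 2 $ 0 = 0 \<and> A $ 2 $ 1 = 0"
  by (auto simp: UT_def forall_3_from_zero)

definition SUT :: "('f::field ^ 3 ^ 3) set"
  where "SUT = {A \<in> UT. \<forall>i. A $ i $ i = 0}"

lemma SUT_iff: "A \<in> SUT \<longleftrightarrow> A \<in> UT \<and> A $ 0 $ 0 = 0 \<and> A $ 1 $ 1 = 0 \<and> A $ 2 $ 2 = 0"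
  by (auto simp: SUT_def forall_3_from_zero)

lemma mat3_eq_iff:
  fixes A B :: "'f ^ 3 ^ 3"
  shows "A = B \<longleftrightarrow> A $ 0 $ 0 = B $ 0 $ 0 \<and> A $ 0 $ 1 = B $ 0 $ 1 \<and> A $ 0 $ 2 = B $ 0 $ 2 \<and>
    A $ 1 $ 0 = B $ 1 $ 0 \<and> A $ 1 $ 1 = B $ 1 $ 1 \<and> A $ 1 $ 2 = B $ 1 $ 2 \<and>
    A $ 2 $ 0 = B $ 2 $ 0 \<and> A $ 2 $ 1 = B $ 2 $ 1 \<and> A $ 2 $ 2 = B $ 2 $ 2"
  by (auto simp: vec_eq_iff forall_3_from_zero)

lemma mat3_mult_nth:
  fixes A B :: "'f::field ^ 3 ^ 3"
  shows "(A ** B) $ i $ j = A $ i $ 0 * B $ 0 $ j + A $ i $ 1 * B $ 1 $ j + A $ i $ 2 * B $ 2 $ j"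
  by (simp add: matrix_matrix_mult_def sum_3_from_zero)

lemma mscale_nth [simp]: "mscale c A $ i $ j = c * A $ i $ j"
  by (simp add: mscale_def map_matrix_def)

definition unit_mat :: "3 \<Rightarrow> 3 \<Rightarrow> 'f::field ^ 3 ^ 3"
  where "unit_mat i j = axis i (axis j 1)"

lemma unit_mat_nth [simp]: "unit_mat i j $ a $ b = (if a = i \<and> b = j then 1 else 0)"
  by (auto simp: unit_mat_def axis_def)

lemmas mat3_simps = UT_iff SUT_iff mat3_eq_iff mat3_mult_nth

lemma unit_mat_UT [simp]:
  "unit_mat 0 0 \<in> UT" "unit_mat 1 1 \<in> UT" "unit_mat 2 2 \<in> UT"
  "unit_mat 0 1 \<in> SUT" "unit_mat 1 2 \<in> SUT" "unit_mat 0 2 \<in> SUT"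
  by (simp_all add: mat3_simps)

lemma SUT_imp_UT [simp]: "A \<in> SUT \<Longrightarrow> A \<in> UT"
  by (simp add: SUT_iff)

lemma subspace_UT: "matrices.subspace (UT :: ('f::field ^ 3 ^ 3) set)"
  by (rule matrices.subspaceI) (auto simp: UT_iff)

lemma subspace_SUT: "matrices.subspace (SUT :: ('f::field ^ 3 ^ 3) set)"
  by (rule matrices.subspaceI) (auto simp: SUT_iff UT_iff)

lemma UT_mult: "A \<in> UT \<Longrightarrow> B \<in> UT \<Longrightarrow> A ** B \<in> (UT :: ('f::field ^ 3 ^ 3) set)"
  by (simp add: mat3_simps)

lemma UT_mult_diag:
  fixes A B :: "'f::field ^ 3 ^ 3"
  assumes "A \<in> UT" "B \<in> UT"
  shows "(A ** B) $ i $ i = A $ i $ i * B $ i $ i"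
proof -
  have "\<forall>i. (A ** B) $ i $ i = A $ i $ i * B $ i $ i"
    using assms by (simp add: forall_3_from_zero mat3_simps)
  then show ?thesis by blast
qed

lemma SUT_mult: "A \<in> SUT \<Longrightarrow> B \<in> SUT \<Longrightarrow> A ** B = mscale (A $ 0 $ 1 * B $ 1 $ 2) (unit_mat 0 2)"
  by (simp add: mat3_simps)

lemma SUT_cube: "A \<in> SUT \<Longrightarrow> A ** (A ** A) = (0 :: 'f::field ^ 3 ^ 3)"
  by (simp add: mat3_simps)

lemma mscale_matrix_mult:
  "mscale c A ** B = mscale c (A ** B)" "A ** mscale c B = mscale c (A ** (B :: 'f::field ^ 'n ^ 'n))"
  using mscale_mult_mscale[of c A 1 B] mscale_mult_mscale[of 1 A c B] by simp_all

lemma commutator_SUT: "A \<in> UT \<Longrightarrow> B \<in> UT \<Longrightarrow> A ** B - B ** A \<in> (SUT :: ('f::field ^ 3 ^ 3) set)"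
  by (simp add: mat3_simps algebra_simps)

text \<open>
  Commutators with diagonal units separate the rows of a strictly upper triangular matrix. So a
  property that holds for commutators and is closed under addition holds on \<open>SUT\<close>.
\<close>

lemma SUT_sum_commutators:
  assumes "A \<in> SUT"
  obtains B C where "B \<in> UT" "C \<in> UT"
    "A = (unit_mat 0 0 ** B - B ** unit_mat 0 0) + (unit_mat 1 1 ** C - C ** unit_mat 1 1)"
  by (rule that[of "mscale (A $ 0 $ 1) (unit_mat 0 1) + mscale (A $ 0 $ 2) (unit_mat 0 2)"
        "mscale (A $ 1 $ 2) (unit_mat 1 2)"])
    (use assms in \<open>simp_all add: mat3_simps\<close>)

text \<open>Since \<open>mat 1 - u\<close> has cube zero, the identity is a polynomial in \<open>u\<close> without constant term.\<close>

lemma mat_1_eq_unipotent_polynomial: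
  fixes u :: "'f::field ^ 3 ^ 3"
  assumes "u - mat 1 \<in> SUT"
  shows "mat 1 = u + u + u - (u ** u + u ** u + u ** u) + u ** (u ** u)"
proof -
  have mat: "(mat 1 :: 'f ^ 3 ^ 3) = unit_mat 0 0 + unit_mat 1 1 + unit_mat 2 2"
    by (simp add: mat3_eq_iff mat_def)
  have "u $ 0 $ 0 = 1" "u $ 1 $ 1 = 1" "u $ 2 $ 2 = 1" "u $ 1 $ 0 = 0" "u $ 2 $ 0 = 0" "u $ 2 $ 1 = 0"
    using assms by (simp_all add: SUT_iff UT_iff mat)
  then show ?thesis
    unfolding mat by (simp add: mat3_eq_iff mat3_mult_nth)
qed

section \<open>Graded involutions on upper triangular matrices\<close>

locale graded_involution_UT3 = group G for G (structure) +
  fixes \<Gamma> :: "'a \<Rightarrow> ('f::field ^ 3 ^ 3) set" and star :: "'f ^ 3 ^ 3 \<Rightarrow> 'f ^ 3 ^ 3"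
  assumes grading: "grading G UT \<Gamma>"
    and graded_star: "graded_involution G UT \<Gamma> star"
begin

lemma comp_subspace: "g \<in> carrier G \<Longrightarrow> matrices.subspace (\<Gamma> g)"
  using grading by (auto simp: grading_def internal_direct_sum_def)

lemmas comp_zero = matrices.subspace_0[OF comp_subspace]
lemmas comp_add = matrices.subspace_add[OF comp_subspace]
lemmas comp_diff = matrices.subspace_diff[OF comp_subspace]
lemmas comp_neg = matrices.subspace_neg[OF comp_subspace]
lemmas comp_scale = matrices.subspace_scale[OF comp_subspace]

lemma UT_eq_sums:
  "UT = {(\<Sum>i\<in>J. x i) | J x. finite J \<and> J \<subseteq> carrier G \<and> (\<forall>i\<in>J. x i \<in> \<Gamma> i)}"
  using grading by (auto simp: grading_def internal_direct_sum_def)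

lemma comp_UT:
  assumes "g \<in> carrier G" "x \<in> \<Gamma> g"
  shows "x \<in> UT"
  unfolding UT_eq_sums
  by (intro CollectI exI[of _ "{g}"] exI[of _ "\<lambda>_. x"]) (use assms in simp)

lemma UT_subset_span: "UT \<subseteq> matrices.span (\<Union>g\<in>carrier G. \<Gamma> g)"
  unfolding UT_eq_sums
proof safe
  fix J x
  assume J: "J \<subseteq> carrier G" "\<forall>i\<in>J. x i \<in> \<Gamma> i"
  show "sum x J \<in> matrices.span (\<Union>g\<in>carrier G. \<Gamma> g)"
    by (rule matrices.span_sum, rule matrices.span_base) (use J in blast)
qed

lemma comp_independent:
  assumes "finite J" "J \<subseteq> carrier G" "\<And>i. i \<in> J \<Longrightarrow> x i \<in> \<Gamma> i" "(\<Sum>i\<in>J. x i) = 0" "i \<in> J"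
  shows "x i = 0"
proof -
  have "\<forall>J x. finite J \<longrightarrow> J \<subseteq> carrier G \<longrightarrow> (\<forall>i\<in>J. x i \<in> \<Gamma> i) \<longrightarrow> (\<Sum>i\<in>J. x i) = 0 \<longrightarrow>
      (\<forall>i\<in>J. x i = 0)"
    using grading by (simp add: grading_def internal_direct_sum_def)
  from this[rule_format, OF assms(1,2) _ assms(4,5)] show ?thesis
    using assms(3) by simp
qed

lemma comp_disjoint:
  assumes "g \<in> carrier G" "h \<in> carrier G" "x \<in> \<Gamma> g" "x \<in> \<Gamma> h" "x \<noteq> 0"
  shows "g = h"
proof (rule ccontr)
  assume "g \<noteq> h"
  let ?x = "\<lambda>i. if i = g then x else - x"
  have "(\<Sum>i\<in>{g, h}. ?x i) = 0"
    using \<open>g \<noteq> h\<close> by simp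
  moreover have "?x i \<in> \<Gamma> i" if "i \<in> {g, h}" for i
    using that assms comp_neg by auto
  ultimately have "?x g = 0"
    using assms by (intro comp_independent[of "{g, h}" ?x]) auto
  then show False
    using assms by simp
qed

lemma comp_disjoint_sum:
  assumes "g \<in> carrier G" "h \<in> carrier G" "k \<in> carrier G" "x \<in> \<Gamma> g" "y \<in> \<Gamma> h" "z \<in> \<Gamma> k"
    and "x = y + z" "g \<noteq> h" "g \<noteq> k"
  shows "x = 0"
proof (cases "h = k")
  case True
  then have "x \<in> \<Gamma> h"
    using assms(6,7) comp_add[OF assms(2,5)] by simp
  then show ?thesis
    using comp_disjoint[OF assms(1,2,4)] assms(8) by blast
next
  case False
  let ?x = "\<lambda>i. if i = g then x else if i = h then - y else - z"
  have "(\<Sum>i\<in>{g, h, k}. ?x i) = 0"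
    using False assms(7-) by simp
  moreover have "?x i \<in> \<Gamma> i" if "i \<in> {g, h, k}" for i
    using that assms(4) comp_neg[OF assms(2,5)] comp_neg[OF assms(3,6)] by auto
  ultimately have "?x g = 0"
    by (intro comp_independent[of "{g, h, k}" ?x]) (simp_all add: assms(1-3))
  then show ?thesis by simp
qed

lemma comp_mult:
  "g \<in> carrier G \<Longrightarrow> h \<in> carrier G \<Longrightarrow> x \<in> \<Gamma> g \<Longrightarrow> y \<in> \<Gamma> h \<Longrightarrow> x ** y \<in> \<Gamma> (g \<otimes> h)"
  using grading by (auto simp: grading_def)

lemma star_simps:
  shows star_UT: "x \<in> UT \<Longrightarrow> star x \<in> UT"
    and star_add: "x \<in> UT \<Longrightarrow> y \<in> UT \<Longrightarrow> star (x + y) = star x + star y"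
    and star_scale: "x \<in> UT \<Longrightarrow> star (mscale c x) = mscale c (star x)"
    and star_mult: "x \<in> UT \<Longrightarrow> y \<in> UT \<Longrightarrow> star (x ** y) = star y ** star x"
    and star_star: "x \<in> UT \<Longrightarrow> star (star x) = x"
  using graded_star by (auto simp: graded_involution_def involution_def)

lemma star_comp: "g \<in> carrier G \<Longrightarrow> x \<in> \<Gamma> g \<Longrightarrow> star x \<in> \<Gamma> g"
  using graded_star by (auto simp: graded_involution_def)

lemma star_zero [simp]: "star 0 = 0"
  using star_scale[of 0 0] by (simp add: UT_iff)

lemma star_eq_zero: "x \<in> UT \<Longrightarrow> star x = 0 \<Longrightarrow> x = 0"
  using star_star by fastforce

lemma star_diff: "x \<in> UT \<Longrightarrow> y \<in> UT \<Longrightarrow> star (x - y) = star x - star y"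
  using star_add[of "x - y" y] matrices.subspace_diff[OF subspace_UT, of x y] by simp

text \<open>
  The involution maps \<open>x ** y\<close> to a product of elements of the same degrees in the opposite order, and
  it preserves the degree of \<open>x ** y\<close>.
\<close>

lemma comp_mult_nonzero_commute:
  assumes "g \<in> carrier G" "h \<in> carrier G" "x \<in> \<Gamma> g" "y \<in> \<Gamma> h" "x ** y \<noteq> 0"
  shows "g \<otimes> h = h \<otimes> g"
proof -
  have UT: "x \<in> UT" "y \<in> UT"
    using assms comp_UT by auto
  have "star (x ** y) \<in> \<Gamma> (g \<otimes> h)"
    using assms comp_mult star_comp by simp
  moreover have "star (x ** y) \<in> \<Gamma> (h \<otimes> g)"
    using assms comp_mult star_comp UT by (simp add: star_mult)
  moreover have "star (x ** y) \<noteq> 0"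
    using assms UT UT_mult star_eq_zero by blast
  ultimately show ?thesis
    using assms comp_disjoint by blast
qed

text \<open>
  Hence the commutator of homogeneous elements is homogeneous, and so the commutator ideal \<open>SUT\<close> is
  spanned by homogeneous elements. If \<open>g \<otimes> h \<noteq> h \<otimes> g\<close>, both products in the commutator vanish.
\<close>

lemma SUT_subset_span: "SUT \<subseteq> matrices.span (\<Union>g\<in>carrier G. \<Gamma> g \<inter> SUT)" (is "_ \<subseteq> ?H")
proof
  have homogeneous: "x ** y - y ** x \<in> ?H"
    if gh: "g \<in> carrier G" "h \<in> carrier G" and xy: "x \<in> \<Gamma> g" "y \<in> \<Gamma> h" for g h x y
  proof (cases "x ** y = 0 \<and> y ** x = 0")
    case True
    then show ?thesis by (simp add: matrices.span_zero)
  next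
    case False
    then have "g \<otimes> h = h \<otimes> g"
      using comp_mult_nonzero_commute gh xy by metis
    then have "y ** x \<in> \<Gamma> (g \<otimes> h)"
      using comp_mult[OF gh(2,1) xy(2,1)] by simp
    then have "x ** y - y ** x \<in> \<Gamma> (g \<otimes> h)"
      using comp_diff comp_mult[OF gh xy] gh by simp
    moreover have "x ** y - y ** x \<in> SUT"
      using commutator_SUT comp_UT gh xy by blast
    ultimately have "x ** y - y ** x \<in> \<Gamma> (g \<otimes> h) \<inter> SUT"
      by blast
    then show ?thesis
      using gh by (intro matrices.span_base) blast
  qed
  have bilinear: "(x + y) ** z - z ** (x + y) = (x ** z - z ** x) + (y ** z - z ** y)"
    "mscale c x ** z - z ** mscale c x = mscale c (x ** z - z ** x)" for c and x y z :: "'f ^ 3 ^ 3"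
    by (simp_all add: mat3_simps algebra_simps)
  have left: "x ** y - y ** x \<in> ?H" if x: "x \<in> UT" and h: "h \<in> carrier G" and y: "y \<in> \<Gamma> h" for x y h
  proof -
    have "x \<in> matrices.span (\<Union>g\<in>carrier G. \<Gamma> g)"
      using x UT_subset_span by blast
    then show ?thesis
    proof (induction rule: matrices.span_induct)
      case base
      show ?case
        by (rule matrices.subspaceI)
          (simp_all add: bilinear matrices.span_zero matrices.span_add matrices.span_scale)
    next
      case (step x)
      then show ?case using homogeneous h y by blast
    qed
  qed
  have commutator: "x ** y - y ** x \<in> ?H" if x: "x \<in> UT" and y: "y \<in> UT" for x y
  proof -
    have "y \<in> matrices.span (\<Union>g\<in>carrier G. \<Gamma> g)"
      using y UT_subset_span by blast
    then have "y ** x - x ** y \<in> ?H"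
    proof (induction rule: matrices.span_induct)
      case base
      show ?case
        by (rule matrices.subspaceI)
          (simp_all add: bilinear matrices.span_zero matrices.span_add matrices.span_scale)
    next
      case (step y)
      then obtain h where "h \<in> carrier G" "y \<in> \<Gamma> h"
        by blast
      then show ?case
        using matrices.span_neg[OF left[OF x]] by fastforce
    qed
    then show ?thesis
      using matrices.span_neg by fastforce
  qed
  fix A :: "'f ^ 3 ^ 3"
  assume "A \<in> SUT"
  then obtain B C where BC: "B \<in> UT" "C \<in> UT"
    and A: "A = (unit_mat 0 0 ** B - B ** unit_mat 0 0) + (unit_mat 1 1 ** C - C ** unit_mat 1 1)"
    by (rule SUT_sum_commutators)
  show "A \<in> ?H"
    unfolding A using BC by (intro matrices.span_add commutator unit_mat_UT)
qed

text \<open>A linear functional that does not vanish on \<open>SUT\<close> does not vanish on all its homogeneous elements.\<close>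

lemma homogeneous_SUT_entry:
  assumes "(unit_mat i j :: 'f ^ 3 ^ 3) \<in> SUT"
  obtains h y where "h \<in> carrier G" "y \<in> \<Gamma> h" "y \<in> SUT" "y $ i $ j \<noteq> 0"
proof (rule ccontr)
  assume no: "\<not> thesis"
  note found = that
  have zero: "y $ i $ j = 0" if "y \<in> (\<Union>g\<in>carrier G. \<Gamma> g \<inter> SUT)" for y
    using that no found by blast
  have "unit_mat i j \<in> matrices.span (\<Union>g\<in>carrier G. \<Gamma> g \<inter> SUT)"
    using assms SUT_subset_span by blast
  then have "unit_mat i j $ i $ j = (0 :: 'f)"
  proof (induction rule: matrices.span_induct)
    case base
    show ?case
      by (rule matrices.subspaceI) simp_all
  qed (rule zero)
  then show False by simp
qed

text \<open>
  Choose homogeneous \<open>y\<close> and \<open>z\<close> with \<open>y ** z\<close> a nonzero multiple of \<open>unit_mat 0 2\<close>. A factor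
  \<open>x\<close> in front, between or behind them multiplies the product by a diagonal entry of \<open>x\<close>. If that
  entry is not zero, the degree of \<open>x\<close> cannot change the degree of the product.
\<close>

lemma diagonal_entry_degree:
  assumes g: "g \<in> carrier G" "x \<in> \<Gamma> g" and "x $ i $ i \<noteq> 0"
  shows "g = \<one>"
proof -
  obtain h y where y: "h \<in> carrier G" "y \<in> \<Gamma> h" "y \<in> SUT" "y $ 0 $ 1 \<noteq> 0"
    using homogeneous_SUT_entry[of 0 1] unit_mat_UT by blast
  obtain k z where z: "k \<in> carrier G" "z \<in> \<Gamma> k" "z \<in> SUT" "z $ 1 $ 2 \<noteq> 0"
    using homogeneous_SUT_entry[of 1 2] unit_mat_UT by blast
  have x: "x \<in> UT"
    using g comp_UT by blast
  define n where "n = y ** z"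
  have n: "n \<in> \<Gamma> (h \<otimes> k)" "n \<noteq> 0"
    using y z comp_mult by (auto simp: n_def mat3_simps)
  have same: "g' = h \<otimes> k" if "g' \<in> carrier G" "mscale c n \<in> \<Gamma> g'" "c \<noteq> 0" for g' c
    using comp_disjoint[of g' "h \<otimes> k" "mscale c n"] that n y z comp_scale by simp
  have "(\<exists>i. x $ i $ i \<noteq> 0)"
    using assms by blast
  then consider "x $ 0 $ 0 \<noteq> 0" | "x $ 1 $ 1 \<noteq> 0" | "x $ 2 $ 2 \<noteq> 0"
    using forall_3_from_zero[of "\<lambda>i. x $ i $ i = 0"] by blast
  then show ?thesis
  proof cases
    case 1
    have "x ** n = mscale (x $ 0 $ 0) n"
      using x y z by (simp add: n_def mat3_simps)
    then have "g \<otimes> (h \<otimes> k) = h \<otimes> k"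
      using same[OF _ _ 1] comp_mult[OF g(1) _ g(2) n(1)] g y z by simp
    then show ?thesis
      using g y z by (simp add: r_cancel_one)
  next
    case 2
    have "(y ** x) ** z = mscale (x $ 1 $ 1) n"
      using x y z by (simp add: n_def mat3_simps)
    moreover have "(y ** x) ** z \<in> \<Gamma> (h \<otimes> g \<otimes> k)"
      using g y z comp_mult by simp
    ultimately have "h \<otimes> g \<otimes> k = h \<otimes> k"
      using same[OF _ _ 2] g y z by simp
    then show ?thesis
      using g y z by (simp add: m_assoc r_cancel_one)
  next
    case 3
    have "n ** x = mscale (x $ 2 $ 2) n"
      using x y z by (simp add: n_def mat3_simps)
    then have "(h \<otimes> k) \<otimes> g = h \<otimes> k"
      using same[OF _ _ 3] comp_mult[OF _ g(1) n(1) g(2)] g y z by simp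
    then show ?thesis
      using g y z by (simp add: l_cancel_one)
  qed
qed

lemma comp_SUT:
  assumes "g \<in> carrier G" "g \<noteq> \<one>" "x \<in> \<Gamma> g"
  shows "x \<in> SUT"
  unfolding SUT_def using diagonal_entry_degree[OF assms(1,3)] comp_UT[OF assms(1,3)] assms(2) by blast

text \<open>
  The components of other degrees being strictly upper triangular, passing to the component of degree
  \<open>\<one>\<close> does not change the diagonal.
\<close>

lemma degree_one_diagonal:
  assumes "x \<in> UT"
  obtains u where "u \<in> \<Gamma> \<one>" "u - x \<in> SUT"
proof -
  have "x \<in> matrices.span (\<Union>g\<in>carrier G. \<Gamma> g)"
    using assms UT_subset_span by blast
  then have "\<exists>u. u \<in> \<Gamma> \<one> \<and> u - x \<in> SUT"
  proof (induction rule: matrices.span_induct)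
    case base
    show ?case
    proof (rule matrices.subspaceI)
      show "0 \<in> {x. \<exists>u. u \<in> \<Gamma> \<one> \<and> u - x \<in> SUT}"
        using comp_zero[OF one_closed] matrices.subspace_0[OF subspace_SUT]
        by (intro CollectI exI[of _ 0]) simp
    next
      fix x y
      assume "x \<in> {x. \<exists>u. u \<in> \<Gamma> \<one> \<and> u - x \<in> SUT}" "y \<in> {x. \<exists>u. u \<in> \<Gamma> \<one> \<and> u - x \<in> SUT}"
      then obtain u v where "u \<in> \<Gamma> \<one>" "u - x \<in> SUT" "v \<in> \<Gamma> \<one>" "v - y \<in> SUT"
        by blast
      then have "u + v \<in> \<Gamma> \<one>" "u + v - (x + y) \<in> SUT"
        using comp_add[OF one_closed, of u v] matrices.subspace_add[OF subspace_SUT, of "u - x" "v - y"]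
        by (simp_all add: add_diff_add)
      then show "x + y \<in> {x. \<exists>u. u \<in> \<Gamma> \<one> \<and> u - x \<in> SUT}"
        by blast
    next
      fix c x
      assume "x \<in> {x. \<exists>u. u \<in> \<Gamma> \<one> \<and> u - x \<in> SUT}"
      then obtain u where "u \<in> \<Gamma> \<one>" "u - x \<in> SUT"
        by blast
      then have "mscale c u \<in> \<Gamma> \<one>" "mscale c u - mscale c x \<in> SUT"
        using comp_scale[OF one_closed, of u c] matrices.subspace_scale[OF subspace_SUT, of "u - x" c]
        by (simp_all add: matrices.scale_right_diff_distrib)
      then show "mscale c x \<in> {x. \<exists>u. u \<in> \<Gamma> \<one> \<and> u - x \<in> SUT}"
        by blast
    qed
  next
    case (step x)
    then obtain g where g: "g \<in> carrier G" "x \<in> \<Gamma> g"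
      by blast
    show ?case
    proof (cases "g = \<one>")
      case True
      then show ?thesis
        using g matrices.subspace_0[OF subspace_SUT] by (intro exI[of _ x]) simp
    next
      case False
      then have "x \<in> SUT"
        using g comp_SUT by blast
      then have "0 - x \<in> SUT"
        using matrices.subspace_neg[OF subspace_SUT] by simp
      then show ?thesis
        using comp_zero[OF one_closed] by blast
    qed
  qed
  then show thesis using that by blast
qed

lemma mat_1_degree_one: "mat 1 \<in> \<Gamma> \<one>"
proof -
  have "(mat 1 :: 'f ^ 3 ^ 3) \<in> UT"
    by (simp add: UT_iff mat_def)
  then obtain u where u: "u \<in> \<Gamma> \<one>" "u - mat 1 \<in> SUT"
    by (rule degree_one_diagonal)
  have powers: "u ** u \<in> \<Gamma> \<one>" "u ** (u ** u) \<in> \<Gamma> \<one>"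
    using comp_mult[of \<one> \<one>] u by simp_all
  have "mat 1 = u + u + u - (u ** u + u ** u + u ** u) + u ** (u ** u)"
    by (rule mat_1_eq_unipotent_polynomial[OF u(2)])
  also have "\<dots> \<in> \<Gamma> \<one>"
    by (rule comp_add comp_diff one_closed u powers)+
  finally show ?thesis .
qed

text \<open>Nilpotency characterizes \<open>SUT\<close> among triangular matrices and is preserved by the involution.\<close>

lemma star_SUT:
  assumes "x \<in> SUT"
  shows "star x \<in> SUT"
proof -
  have UT: "x \<in> UT" "star x \<in> UT"
    using assms star_UT by auto
  have "(star x ** star x) ** star x = star (x ** (x ** x))"
    using star_mult[OF UT(1) UT_mult[OF UT(1) UT(1)]] star_mult[OF UT(1) UT(1)] by metis
  also have "\<dots> = 0"
    unfolding SUT_cube[OF assms] by (rule star_zero)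
  finally have *: "((star x ** star x) ** star x) $ i $ i = 0" for i
    by (metis zero_index)
  have "star x $ i $ i = 0" for i
    using *[of i] unfolding UT_mult_diag[OF UT_mult[OF UT(2) UT(2)] UT(2)] UT_mult_diag[OF UT(2) UT(2)]
    by simp
  then show ?thesis
    unfolding SUT_def using UT(2) by blast
qed

lemma star_corner_multiple:
  obtains r where "star (unit_mat 0 2) = mscale r (unit_mat 0 2)" "r \<noteq> 0"
proof -
  have "unit_mat 0 2 = unit_mat 0 1 ** (unit_mat 1 2 :: 'f ^ 3 ^ 3)"
    by (simp add: mat3_simps)
  then have "star (unit_mat 0 2) = star (unit_mat 1 2) ** star (unit_mat 0 1)"
    by (simp add: star_mult)
  also have "\<dots> = mscale (star (unit_mat 1 2) $ 0 $ 1 * star (unit_mat 0 1) $ 1 $ 2) (unit_mat 0 2)"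
    by (intro SUT_mult star_SUT unit_mat_UT)
  finally obtain r where r: "star (unit_mat 0 2) = mscale r (unit_mat 0 2)"
    by blast
  have "r \<noteq> 0"
  proof
    assume "r = 0"
    then have "unit_mat 0 2 = (0 :: 'f ^ 3 ^ 3)"
      using r star_eq_zero[of "unit_mat 0 2"] by simp
    then show False
      by (simp add: mat3_eq_iff)
  qed
  with r show thesis by (rule that)
qed

text \<open>
  The involution reverses the diagonal and exchanges the positions \<open>(0, 1)\<close> and \<open>(1, 2)\<close> modulo the
  corner. This follows by applying it to the relations that express the diagonal entries of \<open>x\<close>
  through products of \<open>x\<close> with \<open>unit_mat 0 2\<close> and \<open>unit_mat 0 1\<close>.
\<close>

lemma star_diagonal:
  assumes x: "x \<in> UT"
  shows "star x $ 0 $ 0 = x $ 2 $ 2" "star x $ 1 $ 1 = x $ 1 $ 1" "star x $ 2 $ 2 = x $ 0 $ 0"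
    and star_unit_mat_01: "star (unit_mat 0 1) $ 0 $ 1 = 0" "star (unit_mat 0 1) $ 1 $ 2 \<noteq> 0"
proof -
  obtain r where r: "star (unit_mat 0 2) = mscale r (unit_mat 0 2)" "r \<noteq> 0"
    by (rule star_corner_multiple)
  have last: "star y $ 2 $ 2 = y $ 0 $ 0" if y: "y \<in> UT" for y
  proof -
    have "y ** unit_mat 0 2 = mscale (y $ 0 $ 0) (unit_mat 0 2)"
      using y by (simp add: mat3_simps)
    then have "star (y ** unit_mat 0 2) = mscale (y $ 0 $ 0) (mscale r (unit_mat 0 2))"
      using star_scale[of "unit_mat 0 2"] r by simp
    moreover have "star (y ** unit_mat 0 2) = mscale r (unit_mat 0 2) ** star y"
      using y r star_mult[of y "unit_mat 0 2"] by simp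
    ultimately show ?thesis
      using r(2) by (simp add: mat3_simps)
  qed
  have first: "star y $ 0 $ 0 = y $ 2 $ 2" if y: "y \<in> UT" for y
    using last[of "star y"] star_star star_UT y by simp
  let ?s = "star (unit_mat 0 1)"
  have s: "?s \<in> SUT"
    by (simp add: star_SUT)
  have rel: "star y $ 0 $ 0 * ?s $ 0 $ 1 = y $ 1 $ 1 * ?s $ 0 $ 1"
    "star y $ 1 $ 1 * ?s $ 1 $ 2 = y $ 1 $ 1 * ?s $ 1 $ 2" if y: "y \<in> UT" for y
  proof -
    have "unit_mat 0 1 ** y = mscale (y $ 1 $ 1) (unit_mat 0 1) + mscale (y $ 1 $ 2) (unit_mat 0 2)"
      using y by (simp add: mat3_simps)
    then have "star (unit_mat 0 1 ** y) =
        mscale (y $ 1 $ 1) ?s + mscale (y $ 1 $ 2) (mscale r (unit_mat 0 2))"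
      using r by (simp add: star_add star_scale matrices.subspace_scale[OF subspace_UT])
    moreover have "star (unit_mat 0 1 ** y) = star y ** ?s"
      using y by (simp add: star_mult)
    ultimately have eq: "(star y ** ?s) $ i $ j =
        (mscale (y $ 1 $ 1) ?s + mscale (y $ 1 $ 2) (mscale r (unit_mat 0 2))) $ i $ j" for i j
      by simp
    have zero: "?s $ 1 $ 1 = 0" "?s $ 2 $ 1 = 0" "?s $ 2 $ 2 = 0" "star y $ 1 $ 0 = 0"
      using s star_UT[OF y] by (simp_all add: SUT_iff UT_iff)
    show "star y $ 0 $ 0 * ?s $ 0 $ 1 = y $ 1 $ 1 * ?s $ 0 $ 1"
      "star y $ 1 $ 1 * ?s $ 1 $ 2 = y $ 1 $ 1 * ?s $ 1 $ 2"
      using eq[of 0 1] eq[of 1 2] zero by (simp_all add: mat3_mult_nth)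
  qed
  show p: "?s $ 0 $ 1 = 0"
    using rel(1)[of "unit_mat 2 2"] first[of "unit_mat 2 2"] by simp
  show q: "?s $ 1 $ 2 \<noteq> 0"
  proof
    assume "?s $ 1 $ 2 = 0"
    then have "?s = mscale (?s $ 0 $ 2) (unit_mat 0 2)"
      using s p by (simp add: mat3_simps)
    then obtain c where "?s = mscale c (unit_mat 0 2)"
      by blast
    then have "star ?s = mscale c (mscale r (unit_mat 0 2))"
      using star_scale[of "unit_mat 0 2" c] r by simp
    then have "unit_mat 0 1 = mscale c (mscale r (unit_mat 0 2))"
      using star_star[of "unit_mat 0 1"] by simp
    then show False
      by (simp add: mat3_eq_iff)
  qed
  show "star x $ 0 $ 0 = x $ 2 $ 2" "star x $ 1 $ 1 = x $ 1 $ 1" "star x $ 2 $ 2 = x $ 0 $ 0"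
    using first[OF x] last[OF x] rel(2)[OF x] q by simp_all
qed

lemma star_superdiagonal:
  assumes "w \<in> SUT" "w $ 1 $ 2 = 0"
  shows "star w $ 0 $ 1 = 0" "w $ 0 $ 1 \<noteq> 0 \<Longrightarrow> star w $ 1 $ 2 \<noteq> 0"
proof -
  obtain r where r: "star (unit_mat 0 2) = mscale r (unit_mat 0 2)"
    by (rule star_corner_multiple)
  obtain a b where ab: "a = w $ 0 $ 1" "w = mscale a (unit_mat 0 1) + mscale b (unit_mat 0 2)"
    using assms by (simp add: mat3_simps)
  have "mscale c (unit_mat 0 1) \<in> UT" "mscale c (unit_mat 0 2) \<in> UT" for c :: 'f
    by (auto intro!: matrices.subspace_scale[OF subspace_UT])
  then have "star w = mscale a (star (unit_mat 0 1)) + mscale b (mscale r (unit_mat 0 2))"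
    using r unfolding ab(2) by (simp add: star_add star_scale)
  then show "star w $ 0 $ 1 = 0" "w $ 0 $ 1 \<noteq> 0 \<Longrightarrow> star w $ 1 $ 2 \<noteq> 0"
    using star_unit_mat_01[OF unit_mat_UT(1)] ab(1) by simp_all
qed

end

section \<open>The components of the grading\<close>

text \<open>
  The matrices \<open>w\<close>, \<open>star w\<close> and \<open>w ** star w\<close> form a homogeneous basis of \<open>SUT\<close>. The triviality of
  the grading is the question whether \<open>a = \<one>\<close>.
\<close>

locale generated_graded_involution_UT3 = graded_involution_UT3 +
  fixes a and w :: "'f::field ^ 3 ^ 3"
  assumes a: "a \<in> carrier G" and w: "w \<in> \<Gamma> a" "w \<in> SUT" "w $ 0 $ 1 \<noteq> 0" "w $ 1 $ 2 = 0"
begin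

lemma star_w: "star w \<in> \<Gamma> a" "star w \<in> SUT" "star w $ 0 $ 1 = 0" "star w $ 1 $ 2 \<noteq> 0"
  using star_comp[OF a w(1)] star_SUT[OF w(2)] star_superdiagonal[OF w(2,4)] w(3) by auto

lemma w_star_w: "w ** star w = mscale (w $ 0 $ 1 * star w $ 1 $ 2) (unit_mat 0 2)"
  using SUT_mult w(2) star_w(2) by blast

lemma corner_degree: "unit_mat 0 2 \<in> \<Gamma> (a \<otimes> a)"
proof -
  let ?c = "w $ 0 $ 1 * star w $ 1 $ 2"
  have "mscale (inverse ?c) (w ** star w) \<in> \<Gamma> (a \<otimes> a)"
    using comp_scale comp_mult[OF a a w(1) star_w(1)] a by blast
  moreover have "mscale (inverse ?c) (w ** star w) = unit_mat 0 2"
    unfolding w_star_w using w(3) star_w(4) by (simp add: field_simps)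
  ultimately show ?thesis by simp
qed

lemma star_corner: "star (unit_mat 0 2) = unit_mat 0 2"
proof -
  let ?c = "w $ 0 $ 1 * star w $ 1 $ 2"
  have UT: "w \<in> UT" "star w \<in> UT"
    using w(2) star_w(2) by auto
  have "star (w ** star w) = w ** star w"
    using star_mult[OF UT] star_star[OF UT(1)] by simp
  then have "mscale ?c (star (unit_mat 0 2)) = mscale ?c (unit_mat 0 2)"
    unfolding w_star_w using star_scale[of "unit_mat 0 2" ?c] by simp
  then show ?thesis
    using w(3) star_w(4) by simp
qed

lemma SUT_decomposition:
  assumes "y \<in> SUT"
  obtains b c d where "y = mscale b w + mscale c (star w) + mscale d (unit_mat 0 2)"
proof -
  define b c where "b = y $ 0 $ 1 / w $ 0 $ 1" and "c = y $ 1 $ 2 / star w $ 1 $ 2"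
  define d where "d = y $ 0 $ 2 - b * w $ 0 $ 2 - c * star w $ 0 $ 2"
  have "y $ 0 $ 1 = b * w $ 0 $ 1" "y $ 1 $ 2 = c * star w $ 1 $ 2"
    "y $ 0 $ 2 = b * w $ 0 $ 2 + c * star w $ 0 $ 2 + d"
    using w(3) star_w(4) by (simp_all add: b_def c_def d_def)
  then have "y = mscale b w + mscale c (star w) + mscale d (unit_mat 0 2)"
    using assms w(2,4) star_w(2,3) by (simp add: SUT_iff UT_iff mat3_eq_iff)
  then show thesis by (rule that)
qed

lemma w_comb_degree: "mscale b w + mscale c (star w) \<in> \<Gamma> a"
  using comp_add[OF a comp_scale[OF a w(1)] comp_scale[OF a star_w(1)]] .

text \<open>
  The part of \<open>y\<close> in the span of \<open>w\<close> and \<open>star w\<close> has degree \<open>a\<close>, which is neither the degree of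
  \<open>y\<close> nor the degree \<open>a \<otimes> a\<close> of the corner. So this part is zero.
\<close>

lemma comp_SUT_multiple_corner:
  assumes h: "h \<in> carrier G" "h \<noteq> a" and y: "y \<in> \<Gamma> h" "y \<in> SUT"
    and "a \<noteq> \<one>"
  obtains d where "y = mscale d (unit_mat 0 2)"
proof -
  obtain b c d where dec: "y = mscale b w + mscale c (star w) + mscale d (unit_mat 0 2)"
    using SUT_decomposition[OF y(2)] .
  have "a \<noteq> a \<otimes> a"
    using a \<open>a \<noteq> \<one>\<close> l_cancel_one'[OF a a] by blast
  have "mscale (- d) (unit_mat 0 2) \<in> \<Gamma> (a \<otimes> a)"
    by (rule comp_scale[OF m_closed[OF a a] corner_degree])
  moreover have "mscale b w + mscale c (star w) = y + mscale (- d) (unit_mat 0 2)"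
    unfolding dec by simp
  ultimately have "mscale b w + mscale c (star w) = 0"
    using comp_disjoint_sum[OF a h(1) _ w_comb_degree y(1)] a h(2) \<open>a \<noteq> a \<otimes> a\<close> by blast
  then show thesis
    by (intro that[of d]) (simp add: dec)
qed

lemma comp_SUT_plane:
  assumes h: "h \<in> carrier G" and "a \<noteq> \<one>"
  obtains p q where "\<Gamma> h \<inter> SUT \<subseteq> matrices.span {p, q}"
proof (cases "h = a")
  case False
  have "\<Gamma> h \<inter> SUT \<subseteq> matrices.span {unit_mat 0 2, 0}"
  proof
    fix y
    assume "y \<in> \<Gamma> h \<inter> SUT"
    then obtain d where "y = mscale d (unit_mat 0 2)"
      using comp_SUT_multiple_corner h False \<open>a \<noteq> \<one>\<close> by blast
    then show "y \<in> matrices.span {unit_mat 0 2, 0}"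
      by (simp add: matrices.span_scale matrices.span_base)
  qed
  then show thesis by (rule that)
next
  case True
  have "a \<noteq> a \<otimes> a"
    using a \<open>a \<noteq> \<one>\<close> l_cancel_one'[OF a a] by blast
  have "\<Gamma> h \<inter> SUT \<subseteq> matrices.span {w, star w}"
  proof
    fix y
    assume y: "y \<in> \<Gamma> h \<inter> SUT"
    then obtain b c d where dec: "y = mscale b w + mscale c (star w) + mscale d (unit_mat 0 2)"
      using SUT_decomposition by blast
    have "y \<in> \<Gamma> a"
      using y True by blast
    then have "y - (mscale b w + mscale c (star w)) \<in> \<Gamma> a"
      using comp_diff[OF a _ w_comb_degree] by blast
    then have "mscale d (unit_mat 0 2) \<in> \<Gamma> a"
      unfolding dec by simp
    moreover have "mscale d (unit_mat 0 2) \<in> \<Gamma> (a \<otimes> a)"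
      using comp_scale[OF _ corner_degree] a by simp
    ultimately have "mscale d (unit_mat 0 2) = 0"
      using comp_disjoint[OF a _] a \<open>a \<noteq> a \<otimes> a\<close> by blast
    then have "y = mscale b w + mscale c (star w)"
      using dec by simp
    then show "y \<in> matrices.span {w, star w}"
      by (simp add: matrices.span_add matrices.span_scale matrices.span_base)
  qed
  then show thesis by (rule that)
qed

text \<open>
  Thus any two degrees in the support commute, and the degree of a product of homogeneous elements
  does not depend on the order of the factors.
\<close>

lemma support_powers:
  assumes h: "h \<in> carrier G" "\<Gamma> h \<noteq> {0}" and "a \<noteq> \<one>"
  obtains n :: nat where "h = a [^] n"
proof -
  obtain y where y: "y \<in> \<Gamma> h" "y \<noteq> 0"
    using h comp_zero by blast
  consider "h = \<one>" | "h = a" | "h \<noteq> \<one>" "h \<noteq> a"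
    by blast
  then show thesis
  proof cases
    case 1
    then show thesis using that[of 0] by simp
  next
    case 2
    then show thesis using that[of 1] a by simp
  next
    case 3
    then have "y \<in> SUT"
      using comp_SUT h y by blast
    then obtain d where d: "y = mscale d (unit_mat 0 2)"
      using comp_SUT_multiple_corner h y 3 \<open>a \<noteq> \<one>\<close> by blast
    then have "y \<in> \<Gamma> (a \<otimes> a)"
      using comp_scale[OF _ corner_degree] a by simp
    then have "h = a \<otimes> a"
      using comp_disjoint h y a by simp
    then show thesis
      using that[of 2] a by (simp add: numeral_2_eq_2)
  qed
qed

text \<open>
  The commutator of two elements of \<open>\<Gamma> \<one>\<close> is a multiple of the corner, which is symmetric, while
  the commutator of symmetric elements is skew-symmetric.
\<close>

lemma symmetric_commute:
  assumes "a \<noteq> \<one>" and "(2 :: 'f) \<noteq> 0"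
    and x: "x \<in> symmetric_part \<Gamma> star \<one>" and y: "y \<in> symmetric_part \<Gamma> star \<one>"
  shows "x ** y = y ** x"
proof -
  have xy: "x \<in> \<Gamma> \<one>" "y \<in> \<Gamma> \<one>" "star x = x" "star y = y"
    using x y by (auto simp: symmetric_part_def)
  then have UT: "x \<in> UT" "y \<in> UT"
    using comp_UT by auto
  have "x ** y - y ** x \<in> \<Gamma> \<one>"
    using comp_diff[OF one_closed] comp_mult[OF one_closed one_closed] xy by simp
  moreover have "x ** y - y ** x \<in> SUT"
    using commutator_SUT UT by blast
  ultimately obtain d where d: "x ** y - y ** x = mscale d (unit_mat 0 2)"
    using comp_SUT_multiple_corner \<open>a \<noteq> \<one>\<close> by (metis one_closed)
  have "star (x ** y - y ** x) = - (x ** y - y ** x)"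
    using star_diff[OF UT_mult[OF UT] UT_mult[OF UT(2,1)]] star_mult[OF UT] star_mult[OF UT(2,1)] xy
    by simp
  moreover have "star (x ** y - y ** x) = x ** y - y ** x"
    unfolding d using star_scale[of "unit_mat 0 2"] star_corner by simp
  ultimately have "mscale d (unit_mat 0 2) = - mscale d (unit_mat 0 2)"
    using d by simp
  then have "(mscale d (unit_mat 0 2)) $ 0 $ 2 = (- mscale d (unit_mat 0 2)) $ 0 $ 2"
    by (rule arg_cong)
  then have "2 * d = 0"
    by simp
  then have "d = 0"
    using assms(2) by simp
  then show ?thesis
    using d by simp
qed

text \<open>
  An element of degree \<open>\<one>\<close> is determined by its diagonal up to a multiple of the corner. The diagonals
  \<open>(c, 0, e * c)\<close> with \<open>e = \<plusminus> 1\<close> are those of products of symmetric and skew-symmetric elements with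
  at least one skew-symmetric factor.
\<close>

lemma antidiagonal_plane:
  assumes "a \<noteq> \<one>"
  obtains p q where "{x \<in> \<Gamma> \<one>. x $ 1 $ 1 = 0 \<and> x $ 2 $ 2 = e * x $ 0 $ 0} \<subseteq> matrices.span {p, q}"
proof -
  have "unit_mat 0 0 + mscale e (unit_mat 2 2) \<in> UT"
    by (simp add: UT_iff)
  then obtain u where u: "u \<in> \<Gamma> \<one>" "u - (unit_mat 0 0 + mscale e (unit_mat 2 2)) \<in> SUT"
    by (rule degree_one_diagonal)
  then have ud: "u $ 0 $ 0 = 1" "u $ 1 $ 1 = 0" "u $ 2 $ 2 = e"
    by (simp_all add: SUT_iff)
  have "{x \<in> \<Gamma> \<one>. x $ 1 $ 1 = 0 \<and> x $ 2 $ 2 = e * x $ 0 $ 0} \<subseteq> matrices.span {u, unit_mat 0 2}"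
  proof
    fix x
    assume x: "x \<in> {x \<in> \<Gamma> \<one>. x $ 1 $ 1 = 0 \<and> x $ 2 $ 2 = e * x $ 0 $ 0}"
    let ?y = "x - mscale (x $ 0 $ 0) u"
    have y: "?y \<in> \<Gamma> \<one>"
      using comp_diff[OF one_closed _ comp_scale[OF one_closed u(1)]] x by blast
    have "?y $ i $ i = 0" for i
    proof -
      have "\<forall>i. ?y $ i $ i = 0"
        using x ud by (simp add: forall_3_from_zero)
      then show ?thesis by blast
    qed
    then have "?y \<in> SUT"
      using comp_UT[OF one_closed y] unfolding SUT_def by blast
    then obtain d where d: "?y = mscale d (unit_mat 0 2)"
      using comp_SUT_multiple_corner[OF one_closed _ y] assms by metis
    have "x = mscale (x $ 0 $ 0) u + mscale d (unit_mat 0 2)"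
      unfolding d[symmetric] by simp
    moreover have "mscale b u + mscale d (unit_mat 0 2) \<in> matrices.span {u, unit_mat 0 2}" for b
      by (intro matrices.span_add matrices.span_scale matrices.span_base) auto
    ultimately show "x \<in> matrices.span {u, unit_mat 0 2}"
      by metis
  qed
  then show thesis by (rule that)
qed

end

text \<open>
  Cutting a homogeneous element with nonzero \<open>(0, 1)\<close> entry down by diagonal units modulo \<open>SUT\<close>
  leaves the entry \<open>(0, 1)\<close> and the corner. If the resulting \<open>w\<close> had degree \<open>\<one>\<close>, then so would its
  image under the involution and their product, and hence every matrix.
\<close>

lemma (in graded_involution_UT3) ex_generator:
  assumes "\<not> trivial_grading G UT \<Gamma>"
  obtains a w where "a \<noteq> \<one>" "generated_graded_involution_UT3 G \<Gamma> star a w"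
proof -
  obtain a y where y: "a \<in> carrier G" "y \<in> \<Gamma> a" "y \<in> SUT" "y $ 0 $ 1 \<noteq> 0"
    using homogeneous_SUT_entry[of 0 1] unit_mat_UT by blast
  obtain u where u: "u \<in> \<Gamma> \<one>" "u - unit_mat 0 0 \<in> SUT"
    using degree_one_diagonal unit_mat_UT by blast
  obtain v where v: "v \<in> \<Gamma> \<one>" "v - unit_mat 1 1 \<in> SUT"
    using degree_one_diagonal unit_mat_UT by blast
  define w where "w = (u ** y) ** v"
  have "w \<in> \<Gamma> a"
    using comp_mult[OF _ one_closed comp_mult[OF one_closed y(1) u(1) y(2)] v(1)] y(1)
    by (simp add: w_def)
  moreover have "w \<in> SUT" "w $ 0 $ 1 \<noteq> 0" "w $ 1 $ 2 = 0"
    using y(3,4) u(2) v(2) by (simp_all add: w_def SUT_iff UT_iff mat3_mult_nth)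
  ultimately have gen: "generated_graded_involution_UT3 G \<Gamma> star a w"
    using y(1) by unfold_locales
  then interpret generated_graded_involution_UT3 G \<Gamma> star a w .
  have "a \<noteq> \<one>"
  proof
    assume "a = \<one>"
    have SUT: "y \<in> \<Gamma> \<one>" if y: "y \<in> SUT" for y
    proof -
      obtain b c d where "y = mscale b w + mscale c (star w) + mscale d (unit_mat 0 2)"
        using SUT_decomposition[OF y] .
      then show ?thesis
        using comp_add[OF one_closed _ comp_scale[OF one_closed]] w_comb_degree corner_degree
          \<open>a = \<one>\<close> by simp
    qed
    have "x \<in> \<Gamma> \<one>" if x: "x \<in> UT" for x
    proof -
      obtain u where "u \<in> \<Gamma> \<one>" "u - x \<in> SUT"
        using degree_one_diagonal[OF x] .
      then show ?thesis
        using comp_diff[OF one_closed, of u "u - x"] SUT by simp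
    qed
    then have "UT = \<Gamma> \<one>"
      using comp_UT by blast
    then show False
      using assms by (simp add: trivial_grading_def)
  qed
  then show thesis
    using gen by (rule that)
qed

section \<open>Evaluation of multilinear polynomials\<close>

definition matrix_product :: "('f::field ^ 'n ^ 'n) list \<Rightarrow> 'f ^ 'n ^ 'n"
  where "matrix_product xs = foldr (**) xs (mat 1)"

lemma matrix_product_simps [simp]:
  "matrix_product [] = mat 1" "matrix_product (x # xs) = x ** matrix_product xs"
  by (simp_all add: matrix_product_def)

lemma matrix_product_comb:
  assumes "distinct ks" "i \<in> set ks"
  shows "matrix_product (map (v(i := mscale a x + mscale b y)) ks) =
    mscale a (matrix_product (map (v(i := x)) ks)) + mscale b (matrix_product (map (v(i := y)) ks))"
  using assms
proof (induction ks)
  case (Cons k ks)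
  show ?case
  proof (cases "k = i")
    case True
    then have "map (v(i := z)) ks = map v ks" for z
      using Cons.prems by (intro map_cong) auto
    then show ?thesis
      by (simp only: True list.map fun_upd_same matrix_product_simps matrix_right_distrib
          mscale_matrix_mult)
  next
    case False
    then show ?thesis
      using Cons by (simp add: matrix_add_ldistrib mscale_matrix_mult)
  qed
qed simp

lemma matrix_product_eq_zero: "0 \<in> set xs \<Longrightarrow> matrix_product xs = 0"
  by (induction xs) auto

lemma matrix_product_mat_1: "(\<And>x. x \<in> set xs \<Longrightarrow> x = mat 1) \<Longrightarrow> matrix_product xs = mat 1"
  by (induction xs) auto

lemma matrix_product_commute:
  assumes "mset xs = mset ys" "\<And>x y. x \<in> set xs \<Longrightarrow> y \<in> set xs \<Longrightarrow> x ** y = y ** x"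
  shows "matrix_product xs = matrix_product ys"
  unfolding matrix_product_def foldr_conv_fold using assms
  by (intro fun_cong[OF fold_multiset_equiv]) (auto simp: matrix_mul_assoc)

lemma matrix_product_UT:
  assumes "set xs \<subseteq> UT"
  shows "matrix_product xs \<in> (UT :: ('f::field ^ 3 ^ 3) set)"
    and "matrix_product xs $ i $ i = prod_list (map (\<lambda>x. x $ i $ i) xs)"
proof -
  have "(mat 1 :: 'f ^ 3 ^ 3) \<in> UT" "(mat 1 :: 'f ^ 3 ^ 3) $ i $ i = 1"
    by (simp_all add: UT_iff mat_def)
  then have "matrix_product xs \<in> UT \<and> matrix_product xs $ i $ i = prod_list (map (\<lambda>x. x $ i $ i) xs)"
    using assms by (induction xs) (simp_all add: UT_mult UT_mult_diag)
  then show "matrix_product xs \<in> UT"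
    and "matrix_product xs $ i $ i = prod_list (map (\<lambda>x. x $ i $ i) xs)" by auto
qed

lemma matrix_product_SUT:
  assumes "set xs \<subseteq> UT" "y \<in> set xs" "y \<in> SUT"
  shows "matrix_product xs \<in> SUT"
proof -
  have "matrix_product xs $ i $ i = 0" for i
  proof -
    have "y $ i $ i = 0"
      using assms(3) unfolding SUT_def by blast
    then have "0 \<in> set (map (\<lambda>x. x $ i $ i) xs)"
      unfolding set_map using assms(2) by (intro rev_image_eqI[of y]) simp_all
    then show ?thesis
      unfolding matrix_product_UT(2)[OF assms(1)] by (simp only: prod_list_zero_iff)
  qed
  then show ?thesis
    unfolding SUT_def using matrix_product_UT(1)[OF assms(1)] by blast
qed

text \<open>
  The number \<open>i\<close> determines the variable \<open>xi l g i\<close>, so values indexed by numbers suffice to evaluate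
  the elements of \<open>multilinear_polys m l g\<close>.
\<close>

fun substitution :: "(nat \<Rightarrow> 'm) \<Rightarrow> 'g star_variable \<Rightarrow> 'm"
  where "substitution v (Sym i h) = v i"
  | "substitution v (Skew i h) = v i"

lemma substitution_xi [simp]: "substitution v (xi l g i) = v i"
  by (simp add: xi_def)

definition variable_product :: "nat \<Rightarrow> (nat \<Rightarrow> 'g) \<Rightarrow> nat list \<Rightarrow> ('g star_variable, 'f::field) free_algebra"
  where "variable_product l g ks = prod_list (map (\<lambda>i. variable (xi l g i)) ks)"

lemma eval_variable_product:
  "eval \<phi> (variable_product l g ks) = matrix_product (map (\<lambda>i. \<phi> (xi l g i)) ks)"
  by (induction ks) (simp_all add: variable_product_def eval_mult)

lemma multilinear_polys_induct [consumes 1, case_names zero comb product]: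
  assumes "f \<in> multilinear_polys m l g"
    and "P 0"
    and "\<And>c p q. P p \<Longrightarrow> P q \<Longrightarrow> P (fscale c p + q)"
    and "\<And>ks. distinct ks \<Longrightarrow> set ks = {1..m} \<Longrightarrow> P (variable_product l g ks)"
  shows "P f"
  using assms(1) unfolding multilinear_polys_def
proof (induction rule: free_algebra.span_induct_alt)
  case base
  show ?case by (rule assms(2))
next
  case (step c x y)
  then obtain \<sigma> where \<sigma>: "\<sigma> permutes {1..m}"
    "x = prod_list (map (\<lambda>i. variable (xi l g (\<sigma> i))) [1..<Suc m])"
    by blast
  let ?ks = "map \<sigma> [1..<Suc m]"
  have "distinct ?ks"
    using \<sigma>(1) by (simp add: distinct_map permutes_inj_on)
  moreover have "set ?ks = {1..m}"
    using permutes_image[OF \<sigma>(1)] by (simp add: atLeastLessThanSuc_atLeastAtMost del: upt_Suc)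
  moreover have "x = variable_product l g ?ks"
    unfolding \<sigma>(2) variable_product_def map_map comp_def ..
  ultimately show ?case
    using assms(3,4) step by blast
qed

lemma eval_eq_eval_substitution:
  assumes "f \<in> multilinear_polys m l g" "\<And>i. i \<in> {1..m} \<Longrightarrow> \<phi> (xi l g i) = v i"
  shows "eval \<phi> f = eval (substitution v) f"
  using assms(1)
proof (induction rule: multilinear_polys_induct)
  case (product ks)
  then have "map (\<lambda>i. \<phi> (xi l g i)) ks = map v ks"
    using assms(2) by (intro map_cong) auto
  then show ?case
    by (simp only: eval_variable_product substitution_xi)
qed (simp_all add: eval_add eval_fscale)

lemma eval_in_subspace:
  assumes "f \<in> multilinear_polys m l g" and W: "matrices.subspace W"
    and "\<And>ks. distinct ks \<Longrightarrow> set ks = {1..m} \<Longrightarrow> matrix_product (map v ks) \<in> W"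
  shows "eval (substitution v) f \<in> W"
  using assms(1)
proof (induction rule: multilinear_polys_induct)
  case zero
  show ?case using matrices.subspace_0[OF W] by simp
next
  case (comb c p q)
  then show ?case
    by (simp add: eval_add eval_fscale matrices.subspace_add[OF W] matrices.subspace_scale[OF W])
next
  case (product ks)
  then show ?case
    using assms(3) by (simp add: eval_variable_product)
qed

text \<open>The scalar \<open>c\<close> is the sum of the coefficients of \<open>f\<close>; it does not depend on the substitution.\<close>

lemma eval_commuting:
  assumes "f \<in> multilinear_polys m l g"
    and S: "\<And>x y. x \<in> S \<Longrightarrow> y \<in> S \<Longrightarrow> x ** y = y ** x"
  obtains c where "\<And>v. \<forall>i\<in>{1..m}. v i \<in> S \<Longrightarrow>
    eval (substitution v) f = mscale c (matrix_product (map v [1..<Suc m]))"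
proof -
  have "\<exists>c. \<forall>v. (\<forall>i\<in>{1..m}. v i \<in> S) \<longrightarrow>
      eval (substitution v) f = mscale c (matrix_product (map v [1..<Suc m]))"
    using assms(1)
  proof (induction rule: multilinear_polys_induct)
    case zero
    show ?case by (intro exI[of _ 0]) simp
  next
    case (comb b p q)
    then obtain c d where cd: "\<forall>v. (\<forall>i\<in>{1..m}. v i \<in> S) \<longrightarrow>
        eval (substitution v) p = mscale c (matrix_product (map v [1..<Suc m]))"
      "\<forall>v. (\<forall>i\<in>{1..m}. v i \<in> S) \<longrightarrow>
        eval (substitution v) q = mscale d (matrix_product (map v [1..<Suc m]))"
      by blast
    show ?case
    proof (intro exI[of _ "b * c + d"] allI impI)
      fix v
      assume v: "\<forall>i\<in>{1..m}. v i \<in> S"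
      show "eval (substitution v) (fscale b p + q) =
          mscale (b * c + d) (matrix_product (map v [1..<Suc m]))"
        by (simp only: eval_add eval_fscale cd[rule_format, OF v[rule_format]]
            matrices.scale_left_distrib matrices.scale_scale)
    qed
  next
    case (product ks)
    have "matrix_product (map v ks) = matrix_product (map v [1..<Suc m])"
      if v: "\<forall>i\<in>{1..m}. v i \<in> S" for v
    proof (rule matrix_product_commute)
      have "mset ks = mset [1..<Suc m]"
        using product by (metis atLeastLessThanSuc_atLeastAtMost distinct_upt mset_set_set set_upt)
      then show "mset (map v ks) = mset (map v [1..<Suc m])"
        by (simp only: mset_map)
    qed (use v product S in auto)
    then show ?case
      by (intro exI[of _ 1]) (simp add: eval_variable_product del: upt_Suc)
  qed
  then obtain c where c: "\<forall>v. (\<forall>i\<in>{1..m}. v i \<in> S) \<longrightarrow>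
      eval (substitution v) f = mscale c (matrix_product (map v [1..<Suc m]))" ..
  show thesis
    by (rule that[of c]) (rule c[rule_format], blast)
qed

lemma poly_image_eq:
  assumes "f \<in> multilinear_polys m l g" "l \<le> m"
  shows "poly_image \<Gamma> star m l g f = {eval (substitution v) f | v. \<forall>i\<in>{1..m}.
    v i \<in> (if i \<le> l then symmetric_part \<Gamma> star (g i) else skew_part \<Gamma> star (g i))}" (is "_ = ?R")
proof (intro equalityI subsetI)
  fix x
  assume "x \<in> poly_image \<Gamma> star m l g f"
  then obtain \<phi> where \<phi>: "x = eval \<phi> f"
    "\<forall>i\<in>{1..l}. \<phi> (Sym i (g i)) \<in> symmetric_part \<Gamma> star (g i)"
    "\<forall>j\<in>{l+1..m}. \<phi> (Skew j (g j)) \<in> skew_part \<Gamma> star (g j)"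
    by (auto simp: poly_image_def)
  have "x = eval (substitution (\<lambda>i. \<phi> (xi l g i))) f"
    unfolding \<phi>(1) by (rule eval_eq_eval_substitution[OF assms(1)]) simp
  then show "x \<in> ?R"
    using \<phi>(2,3) by (intro CollectI exI[of _ "\<lambda>i. \<phi> (xi l g i)"]) (auto simp: xi_def)
next
  fix x
  assume "x \<in> ?R"
  then obtain v where v: "x = eval (substitution v) f" "\<forall>i\<in>{1..m}.
      v i \<in> (if i \<le> l then symmetric_part \<Gamma> star (g i) else skew_part \<Gamma> star (g i))"
    by blast
  have "v i \<in> symmetric_part \<Gamma> star (g i)" if "i \<in> {1..l}" for i
    using v(2)[rule_format, of i] that assms(2) by simp
  moreover have "v i \<in> skew_part \<Gamma> star (g i)" if "i \<in> {l+1..m}" for i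
    using v(2)[rule_format, of i] that by simp
  ultimately show "x \<in> poly_image \<Gamma> star m l g f"
    unfolding poly_image_def v(1) by (intro CollectI exI[of _ "substitution v"]) simp
qed

section \<open>Images of multilinear polynomials\<close>

lemma (in graded_involution_UT3) part_subspace:
  assumes h: "h \<in> carrier G"
  shows "matrices.subspace (symmetric_part \<Gamma> star h)" "matrices.subspace (skew_part \<Gamma> star h)"
proof -
  note UT = comp_UT[OF h]
  show "matrices.subspace (symmetric_part \<Gamma> star h)"
    by (rule matrices.subspaceI)
      (auto simp: symmetric_part_def UT star_add star_scale intro: comp_zero[OF h] comp_add[OF h] comp_scale[OF h])
  show "matrices.subspace (skew_part \<Gamma> star h)"
    by (rule matrices.subspaceI)
      (auto simp: skew_part_def UT star_add star_scale intro: comp_zero[OF h] comp_add[OF h] comp_scale[OF h])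
qed

lemma (in graded_involution_UT3) homogeneous_if_in_component:
  assumes h: "h \<in> carrier G" and V: "matrices.subspace V" "V \<subseteq> \<Gamma> h"
  shows "homogeneous G \<Gamma> V"
  unfolding homogeneous_def internal_direct_sum_def
proof (intro conjI ballI allI impI)
  fix k
  assume "k \<in> carrier G"
  then show "matrices.subspace (V \<inter> \<Gamma> k)"
    using V comp_subspace by (intro matrices.subspace_inter)
next
  show "V = {(\<Sum>i\<in>J. x i) | J x. finite J \<and> J \<subseteq> carrier G \<and> (\<forall>i\<in>J. x i \<in> V \<inter> \<Gamma> i)}" (is "_ = ?S")
  proof (intro equalityI subsetI)
    fix x
    assume "x \<in> V"
    then show "x \<in> ?S"
      using h V by (intro CollectI exI[of _ "{h}"] exI[of _ "\<lambda>_. x"]) auto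
  next
    fix x
    assume "x \<in> ?S"
    then show "x \<in> V"
      by (auto intro!: matrices.subspace_sum[OF V(1)])
  qed
next
  fix J x i
  assume "finite J" "J \<subseteq> carrier G" "\<forall>i\<in>J. x i \<in> V \<inter> \<Gamma> i" "(\<Sum>i\<in>J. x i) = 0" "i \<in> J"
  then show "x i = 0"
    by (intro comp_independent[of J x i]) auto
qed

context generated_graded_involution_UT3
begin

lemma matrix_product_degree:
  assumes "\<And>i. i \<in> set ks \<Longrightarrow> v i \<in> \<Gamma> (a [^] (n i :: nat))"
  shows "matrix_product (map v ks) \<in> \<Gamma> (a [^] sum_list (map n ks))"
  using assms
proof (induction ks)
  case Nil
  show ?case by (simp add: mat_1_degree_one)
next
  case (Cons k ks)
  then have "v k ** matrix_product (map v ks) \<in> \<Gamma> (a [^] n k \<otimes> a [^] sum_list (map n ks))"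
    using a by (intro comp_mult) auto
  then show ?case
    using a by (simp add: nat_pow_mult)
qed

lemma symmetric_one_closed:
  assumes "a \<noteq> \<one>" and "(2 :: 'f) \<noteq> 0"
  shows "mat 1 \<in> symmetric_part \<Gamma> star \<one>"
    and "x \<in> symmetric_part \<Gamma> star \<one> \<Longrightarrow> y \<in> symmetric_part \<Gamma> star \<one> \<Longrightarrow>
      x ** y \<in> symmetric_part \<Gamma> star \<one>"
proof -
  have UT: "(mat 1 :: 'f ^ 3 ^ 3) \<in> UT" "star (mat 1) \<in> UT"
    using comp_UT[OF one_closed mat_1_degree_one] star_UT by auto
  have "star (mat 1) = mat 1"
    using star_mult[OF UT] star_star[OF UT(1)] by simp
  then show "mat 1 \<in> symmetric_part \<Gamma> star \<one>"
    using mat_1_degree_one by (simp add: symmetric_part_def)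
  assume xy: "x \<in> symmetric_part \<Gamma> star \<one>" "y \<in> symmetric_part \<Gamma> star \<one>"
  then have xy': "x \<in> \<Gamma> \<one>" "y \<in> \<Gamma> \<one>" "star x = x" "star y = y"
    by (auto simp: symmetric_part_def)
  have "star (x ** y) = x ** y"
    using star_mult[OF comp_UT[OF one_closed xy'(1)] comp_UT[OF one_closed xy'(2)]]
      symmetric_commute[OF assms xy] xy' by simp
  then show "x ** y \<in> symmetric_part \<Gamma> star \<one>"
    using comp_mult[OF one_closed one_closed xy'(1,2)] by (simp add: symmetric_part_def)
qed

lemma skew_diagonal:
  assumes "h \<in> carrier G" "(2 :: 'f) \<noteq> 0" "x \<in> skew_part \<Gamma> star h"
  shows "x $ 1 $ 1 = 0" "x $ 2 $ 2 = - x $ 0 $ 0"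
proof -
  have x: "x \<in> UT" "star x = - x"
    using assms comp_UT by (auto simp: skew_part_def)
  have "x $ 1 $ 1 = - x $ 1 $ 1"
    using star_diagonal(2)[OF x(1)] x(2) by simp
  then have "2 * x $ 1 $ 1 = 0"
    by simp
  then show "x $ 1 $ 1 = 0"
    using assms(2) by simp
  show "x $ 2 $ 2 = - x $ 0 $ 0"
    using star_diagonal(1)[OF x(1)] x(2) by simp
qed

text \<open>
  The four cases are: a variable that takes only the value zero; a variable of degree different from
  \<open>\<one>\<close>; only degree \<open>\<one>\<close> and a skew-symmetric variable; only symmetric variables of degree \<open>\<one>\<close>.
  In the first three the values of every monomial lie in one plane that does not depend on the
  monomial.
\<close>

lemma image_subspace_of_component:
  assumes "a \<noteq> \<one>" and two: "(2 :: 'f) \<noteq> 0"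
    and "1 \<le> m" "l \<le> m" and g: "\<forall>i\<in>{1..m}. g i \<in> carrier G"
    and f: "f \<in> multilinear_polys m l g"
  shows "\<exists>h\<in>carrier G. matrices.subspace (poly_image \<Gamma> star m l g f) \<and> poly_image \<Gamma> star m l g f \<subseteq> \<Gamma> h"
proof -
  define V where "V i = (if i \<le> l then symmetric_part \<Gamma> star (g i) else skew_part \<Gamma> star (g i))" for i
  let ?F = "\<lambda>v. eval (substitution v) f"
  note image = poly_image_eq[OF f \<open>l \<le> m\<close>, of \<Gamma> star, folded V_def]
  have V: "matrices.subspace (V i)" "V i \<subseteq> \<Gamma> (g i)" if "i \<in> {1..m}" for i
    using part_subspace[of "g i"] g that by (auto simp: V_def symmetric_part_def skew_part_def)
  have V_UT: "V i \<subseteq> UT" if "i \<in> {1..m}" for i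
    using V(2)[OF that] comp_UT g that by blast
  interpret F: multilinear_map mscale mscale "{1..m}" V ?F
  proof
    show "?F v = ?F u" if "\<And>i. i \<in> {1..m} \<Longrightarrow> v i = u i" for v u
      using eval_eq_eval_substitution[OF f, of "substitution v" u] that by simp
  next
    show "?F (v(i := mscale b x + mscale c y)) = mscale b (?F (v(i := x))) + mscale c (?F (v(i := y)))"
      if "i \<in> {1..m}" for v i x y b c
      using f
    proof (induction rule: multilinear_polys_induct)
      case (comb d p q)
      then show ?case
        by (simp add: eval_add eval_fscale matrices.scale_right_distrib mult.commute algebra_simps)
    next
      case (product ks)
      then show ?case
        using matrix_product_comb[of ks i v] that
        by (simp only: eval_variable_product substitution_xi)
    qed simp
  qed (use V in auto)
  have plane: "?thesis"
    if h: "h \<in> carrier G" and W: "matrices.subspace W" "W \<subseteq> matrices.span {p, q}"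
      and val: "\<And>v ks. (\<And>i. i \<in> {1..m} \<Longrightarrow> v i \<in> V i) \<Longrightarrow> distinct ks \<Longrightarrow> set ks = {1..m} \<Longrightarrow>
        matrix_product (map v ks) \<in> \<Gamma> h \<inter> W" for h W p q
  proof -
    have sub: "matrices.subspace (\<Gamma> h \<inter> W)"
      using comp_subspace[OF h] W(1) by (rule matrices.subspace_inter)
    have F: "?F v \<in> \<Gamma> h \<inter> W" if "\<And>i. i \<in> {1..m} \<Longrightarrow> v i \<in> V i" for v
      by (rule eval_in_subspace[OF f sub]) (use val that in blast)
    then have "matrices.subspace (poly_image \<Gamma> star m l g f)"
      unfolding image using W(2) \<open>1 \<le> m\<close> by (intro F.image_subspace) auto
    moreover have "poly_image \<Gamma> star m l g f \<subseteq> \<Gamma> h"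
      unfolding image using F by blast
    ultimately show ?thesis using h by blast
  qed
  consider (zero) i where "i \<in> {1..m}" "\<Gamma> (g i) = {0}"
    | (strict) "\<forall>i\<in>{1..m}. \<Gamma> (g i) \<noteq> {0}" "\<exists>i\<in>{1..m}. g i \<noteq> \<one>"
    | (skew) "\<forall>i\<in>{1..m}. g i = \<one>" "l < m"
    | (symmetric) "\<forall>i\<in>{1..m}. g i = \<one>" "l = m"
    using \<open>l \<le> m\<close> by fastforce
  then show ?thesis
  proof cases
    case zero
    show ?thesis
    proof (rule plane[OF one_closed])
      show "matrix_product (map v ks) \<in> \<Gamma> \<one> \<inter> {0}"
        if "\<And>i. i \<in> {1..m} \<Longrightarrow> v i \<in> V i" "distinct ks" "set ks = {1..m}" for v ks
      proof -
        have "v i = 0"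
          using that(1)[OF zero(1)] V(2)[OF zero(1)] zero(2) by auto
        then have "0 \<in> set (map v ks)"
          using that(3) zero(1) by force
        then show ?thesis
          using comp_zero[OF one_closed] by (simp only: matrix_product_eq_zero IntI singletonI)
      qed
    qed (auto intro: matrices.subspace_single_0 matrices.span_zero)
  next
    case strict
    have "\<forall>i. \<exists>n::nat. i \<in> {1..m} \<longrightarrow> g i = a [^] n"
      using support_powers[OF _ _ \<open>a \<noteq> \<one>\<close>] strict(1) g by metis
    then obtain n :: "nat \<Rightarrow> nat" where n: "\<And>i. i \<in> {1..m} \<Longrightarrow> g i = a [^] n i"
      by metis
    \<comment> \<open>The degree of a product of powers of \<open>a\<close> does not depend on the order of the factors.\<close>
    let ?h = "a [^] (\<Sum>i\<in>{1..m}. n i)"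
    obtain j where j: "j \<in> {1..m}" "g j \<noteq> \<one>"
      using strict(2) by blast
    have h: "?h \<in> carrier G"
      using a by simp
    obtain p q where pq: "\<Gamma> ?h \<inter> SUT \<subseteq> matrices.span {p, q}"
      using comp_SUT_plane[OF h \<open>a \<noteq> \<one>\<close>] .
    show ?thesis
    proof (rule plane[OF h _ pq])
      show "matrices.subspace (\<Gamma> ?h \<inter> SUT)"
        using comp_subspace[OF h] subspace_SUT by (rule matrices.subspace_inter)
      show "matrix_product (map v ks) \<in> \<Gamma> ?h \<inter> (\<Gamma> ?h \<inter> SUT)"
        if v: "\<And>i. i \<in> {1..m} \<Longrightarrow> v i \<in> V i" and ks: "distinct ks" "set ks = {1..m}" for v ks
      proof -
        have "v i \<in> \<Gamma> (a [^] n i)" if "i \<in> set ks" for i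
          using v[of i] V(2)[of i] n[of i] that ks(2) by auto
        then have "matrix_product (map v ks) \<in> \<Gamma> (a [^] sum_list (map n ks))"
          by (rule matrix_product_degree)
        moreover have "sum_list (map n ks) = (\<Sum>i\<in>{1..m}. n i)"
          using sum_list_distinct_conv_sum_set[OF ks(1), of n] ks(2) by simp
        ultimately have deg: "matrix_product (map v ks) \<in> \<Gamma> ?h"
          by simp
        have "v j \<in> SUT"
          using comp_SUT[of "g j" "v j"] j v V(2) g by blast
        moreover have "set (map v ks) \<subseteq> UT"
          unfolding set_map ks(2) using v V_UT by blast
        ultimately have "matrix_product (map v ks) \<in> SUT"
          using j(1) ks(2) by (intro matrix_product_SUT[of _ "v j"]) auto
        with deg show ?thesis by blast
      qed
    qed
  next
    case skew
    \<comment> \<open>A symmetric factor has diagonal \<open>(c, d, c)\<close> and a skew-symmetric one \<open>(c, 0, - c)\<close>.\<close>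
    define e where "e i = (if i \<le> l then 1 else - 1 :: 'f)" for i
    let ?e = "\<Prod>i\<in>{1..m}. e i"
    let ?W = "{x \<in> \<Gamma> \<one>. x $ 1 $ 1 = 0 \<and> x $ 2 $ 2 = ?e * x $ 0 $ 0}"
    obtain p q where pq: "?W \<subseteq> matrices.span {p, q}"
      using antidiagonal_plane[OF \<open>a \<noteq> \<one>\<close>] .
    show ?thesis
    proof (rule plane[OF one_closed _ pq])
      show "matrices.subspace ?W"
        by (rule matrices.subspaceI)
          (auto simp: algebra_simps intro: comp_zero[OF one_closed] comp_add[OF one_closed] comp_scale[OF one_closed])
      show "matrix_product (map v ks) \<in> \<Gamma> \<one> \<inter> ?W"
        if v: "\<And>i. i \<in> {1..m} \<Longrightarrow> v i \<in> V i" and ks: "distinct ks" "set ks = {1..m}" for v ks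
      proof -
        have "v i \<in> \<Gamma> (a [^] (0::nat))" if "i \<in> set ks" for i
          using v[of i] V(2)[of i] skew(1) that ks(2) by auto
        then have "matrix_product (map v ks) \<in> \<Gamma> (a [^] sum_list (map (\<lambda>_. 0::nat) ks))"
          by (rule matrix_product_degree)
        then have deg: "matrix_product (map v ks) \<in> \<Gamma> \<one>"
          by (simp add: sum_list_0)
        have UT: "set (map v ks) \<subseteq> UT"
          unfolding set_map ks(2) using v V_UT by blast
        have diag: "matrix_product (map v ks) $ i $ i = (\<Prod>k\<in>{1..m}. v k $ i $ i)" for i
          using matrix_product_UT(2)[OF UT, of i] prod.distinct_set_conv_list[OF ks(1), of "\<lambda>k. v k $ i $ i"]
            ks(2) by (simp add: comp_def)
        have "v m \<in> skew_part \<Gamma> star \<one>"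
          using v[of m] skew \<open>1 \<le> m\<close> by (auto simp: V_def)
        then have "v m $ 1 $ 1 = 0"
          using skew_diagonal(1)[OF one_closed two] by blast
        then have "matrix_product (map v ks) $ 1 $ 1 = 0"
          unfolding diag using \<open>1 \<le> m\<close> by (intro prod_zero) auto
        moreover have "v k $ 2 $ 2 = e k * v k $ 0 $ 0" if k: "k \<in> {1..m}" for k
        proof (cases "k \<le> l")
          case True
          then have "star (v k) = v k"
            using v[OF k] by (simp add: V_def symmetric_part_def)
          then show ?thesis
            using star_diagonal(1)[of "v k"] v[OF k] V_UT[OF k] True by (auto simp: e_def)
        next
          case False
          then have "v k \<in> skew_part \<Gamma> star \<one>"
            using v[OF k] skew(1) k by (simp add: V_def)
          then show ?thesis
            using skew_diagonal(2)[OF one_closed two] False by (simp add: e_def)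
        qed
        then have "matrix_product (map v ks) $ 2 $ 2 = ?e * matrix_product (map v ks) $ 0 $ 0"
          unfolding diag by (simp add: prod.distrib)
        ultimately show ?thesis
          using deg by blast
      qed
    qed
  next
    case symmetric
    let ?S = "symmetric_part \<Gamma> star \<one>"
    have VS: "V i = ?S" if "i \<in> {1..m}" for i
      using that symmetric by (simp add: V_def)
    note S = symmetric_one_closed[OF \<open>a \<noteq> \<one>\<close> two]
    obtain c where c: "\<And>v. \<forall>i\<in>{1..m}. v i \<in> ?S \<Longrightarrow>
        ?F v = mscale c (matrix_product (map v [1..<Suc m]))"
      by (rule eval_commuting[OF f, of ?S]) (use symmetric_commute[OF \<open>a \<noteq> \<one>\<close> two] in blast)+
    have closed: "set xs \<subseteq> ?S \<Longrightarrow> matrix_product xs \<in> ?S" for xs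
      by (induction xs) (auto simp: S)
    have "poly_image \<Gamma> star m l g f = mscale c ` ?S"
    proof (intro equalityI subsetI)
      fix x
      assume "x \<in> poly_image \<Gamma> star m l g f"
      then obtain v where v: "x = ?F v" "\<And>i. i \<in> {1..m} \<Longrightarrow> v i \<in> ?S"
        unfolding image using VS by blast
      have "matrix_product (map v [1..<Suc m]) \<in> ?S"
        using v(2) by (intro closed) (auto simp del: upt_Suc)
      then show "x \<in> mscale c ` ?S"
        using c[of v] v by blast
    next
      fix x
      assume "x \<in> mscale c ` ?S"
      then obtain y where y: "x = mscale c y" "y \<in> ?S"
        by blast
      \<comment> \<open>The remaining variables take the value \<open>mat 1\<close>, which is symmetric of degree \<open>\<one>\<close>.\<close>
      define v where "v i = (if i = 1 then y else mat 1)" for i :: nat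
      have v: "v i \<in> ?S" for i
        using y(2) S(1) by (simp add: v_def)
      have "map v [1..<Suc m] = v 1 # map v [Suc 1..<Suc m]"
        using \<open>1 \<le> m\<close> by (simp add: upt_conv_Cons del: upt_Suc)
      moreover have "matrix_product (map v [Suc 1..<Suc m]) = mat 1"
        by (rule matrix_product_mat_1) (auto simp: v_def simp del: upt_Suc)
      ultimately have "matrix_product (map v [1..<Suc m]) = y"
        by (simp add: v_def del: upt_Suc)
      then have "x = ?F v"
        using c[of v] v y(1) by simp
      moreover have "\<forall>i\<in>{1..m}. v i \<in> V i"
        using v VS by blast
      ultimately show "x \<in> poly_image \<Gamma> star m l g f"
        unfolding image by blast
    qed
    moreover have "matrices.subspace (mscale c ` ?S)"
    proof (rule matrices.subspaceI)
      note sub = part_subspace(1)[OF one_closed]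
      show "0 \<in> mscale c ` ?S"
        using matrices.subspace_0[OF sub] by force
      show "x + y \<in> mscale c ` ?S" if xy: "x \<in> mscale c ` ?S" "y \<in> mscale c ` ?S" for x y
      proof -
        obtain x' y' where "x = mscale c x'" "y = mscale c y'" "x' \<in> ?S" "y' \<in> ?S"
          using xy by blast
        then show ?thesis
          using matrices.subspace_add[OF sub, of x' y'] by (metis imageI matrices.scale_right_distrib)
      qed
      show "mscale b x \<in> mscale c ` ?S" if x: "x \<in> mscale c ` ?S" for b x
      proof -
        obtain x' where "x = mscale c x'" "x' \<in> ?S"
          using x by blast
        then have "mscale b x = mscale c (mscale b x')" "mscale b x' \<in> ?S"
          using matrices.subspace_scale[OF sub, of x' b] by (simp_all add: mult.commute)
        then show ?thesis by blast
      qed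
    qed
    moreover have "mscale c ` ?S \<subseteq> \<Gamma> \<one>"
      by (auto simp: symmetric_part_def intro: comp_scale[OF one_closed])
    ultimately show ?thesis by auto
  qed
qed

end

theorem theorem4p2:
  fixes G :: "('g, 'k) monoid_scheme"
    and \<Gamma> :: "'g \<Rightarrow> ('f::alg_closed_field ^ 3 ^ 3) set"
    and star :: "'f ^ 3 ^ 3 \<Rightarrow> 'f ^ 3 ^ 3"
    and m l :: nat
    and g :: "nat \<Rightarrow> 'g"
    and f :: "('g star_variable, 'f) free_algebra"
  assumes "CHAR('f) \<noteq> 2"
    and "group G"
    and "grading G UT \<Gamma>"
    and "\<not> trivial_grading G UT \<Gamma>"
    and "generate G (supp G \<Gamma>) = carrier G"
    and "graded_involution G UT \<Gamma> star"
    and "1 \<le> m" and "l \<le> m"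
    and "\<forall>i\<in>{1..m}. g i \<in> carrier G"
    and "f \<in> multilinear_polys m l g"
  shows "matrices.subspace (poly_image \<Gamma> star m l g f)
    \<and> poly_image \<Gamma> star m l g f \<subseteq> UT
    \<and> homogeneous G \<Gamma> (poly_image \<Gamma> star m l g f)"
proof -
  have two: "(2 :: 'f) \<noteq> 0"
  proof
    assume "(2 :: 'f) = 0"
    then have "CHAR('f) dvd 2"
      using of_nat_eq_0_iff_char_dvd[of 2, where 'a = 'f] by simp
    then have "CHAR('f) = 1"
      using assms(1) two_is_prime_nat by (auto simp: prime_nat_iff)
    then show False by simp
  qed
  interpret graded_involution_UT3 G \<Gamma> star
    using assms by (simp add: graded_involution_UT3_def graded_involution_UT3_axioms_def)
  obtain a w where "a \<noteq> \<one>\<^bsub>G\<^esub>" and gen: "generated_graded_involution_UT3 G \<Gamma> star a w"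
    using ex_generator[OF assms(4)] .
  interpret generated_graded_involution_UT3 G \<Gamma> star a w
    by (rule gen)
  obtain h where h: "h \<in> carrier G" "matrices.subspace (poly_image \<Gamma> star m l g f)"
    "poly_image \<Gamma> star m l g f \<subseteq> \<Gamma> h"
    using image_subspace_of_component[OF \<open>a \<noteq> \<one>\<^bsub>G\<^esub>\<close> two assms(7-10)] by blast
  then show ?thesis
    using homogeneous_if_in_component[OF h] comp_UT by blast
qed

end
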